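(* Let $d\ge2$ be an integer, let $0<a\le 1/d$, and let $W$ be the graphon on $[0,1]^d$ (with Lebesgue measure) given by $W(x,y)=a\,x\cdot y=a(x_1y_1+\cdots+x_dy_d)$ for $x=(x_1,\dots,x_d),\,y=(y_1,\dots,y_d)\in[0,1]^d$. Then $W$ is not equivalent to any graphon on $[0,1]$ (with Lebesgue measure) that is Hölder$(\alpha)$ for any $\alpha\in(0,1]$ with $\alpha>1/d$. In particular, $W$ is not equivalent to any Lipschitz or differentiable graphon on $[0,1]$.
   Context: A graphon on a probability space $(\mathcal S,\mathcal F,\mu)$ is a symmetric measurable function $W:\mathcal S^2\to[0,1]$. The spaces $[0,1]$ and $[0,1]^d$ are regarded as probability spaces with Lebesgue measure. Equivalence: two graphons $W_1$ on $(\mathcal S_1,\mu_1)$ and $W_2$ on $(\mathcal S_2,\mu_2)$ (possibly different probability spaces) are equivalent (weakly isomorphic) if $t(F,W_1)=t(F,W_2)$ for every finite simple graph $F$, where $t(F,W)=\int_{\mathcal S^{V(F)}}\prod_{ij\in E(F)}W(x_i,x_j)\prod_{i\in V(F)}d\mu(x_i)$. Hölder continuity: for $\alpha\in(0,1]$, a real function $f$ on a subset $D$ of a Euclidean space is Hölder$(\alpha)$ if there is a constant $C<\infty$ with $|f(x)-f(y)|\le C|x-y|^\alpha$ for all $x,y\in D$; Lipschitz means Hölder$(1)$. A graphon on $[0,1]$ is regarded as a function on $[0,1]^2\subset\mathbb R^2$ for this purpose. *)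

theory Defs
  imports "HOL-Probability.Probability"
begin

definition graphon :: "'a measure \<Rightarrow> ('a \<Rightarrow> 'a \<Rightarrow> real) \<Rightarrow> bool" where
  "graphon M W \<longleftrightarrow> prob_space M \<and>
     (\<lambda>(x, y). W x y) \<in> borel_measurable (M \<Otimes>\<^sub>M M) \<and>
     (\<forall>x\<in>space M. \<forall>y\<in>space M. W x y = W y x \<and> 0 \<le> W x y \<and> W x y \<le> 1)"

text \<open>Every finite simple graph is isomorphic to one whose vertices are natural numbers, so
  the vertex type is fixed to \<^typ>\<open>nat\<close>.\<close>

definition simple_graph :: "nat set \<Rightarrow> nat set set \<Rightarrow> bool" where
  "simple_graph V E \<longleftrightarrow> finite V \<and> E \<subseteq> {e. e \<subseteq> V \<and> card e = 2}"

text \<open>An edge is a set \<open>e = {i, j}\<close>; it is read as the pair \<open>(Min e, Max e)\<close>. Since graphons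
  are symmetric, the order of the two endpoints is irrelevant.\<close>

definition hom_density ::
    "nat set \<Rightarrow> nat set set \<Rightarrow> 'a measure \<Rightarrow> ('a \<Rightarrow> 'a \<Rightarrow> real) \<Rightarrow> real" where
  "hom_density V E M W =
     (\<integral>x. (\<Prod>e\<in>E. W (x (Min e)) (x (Max e))) \<partial>(\<Pi>\<^sub>M i\<in>V. M))"

definition equivalent_graphons ::
    "'a measure \<Rightarrow> ('a \<Rightarrow> 'a \<Rightarrow> real) \<Rightarrow> 'b measure \<Rightarrow> ('b \<Rightarrow> 'b \<Rightarrow> real) \<Rightarrow> bool" where
  "equivalent_graphons M\<^sub>1 W\<^sub>1 M\<^sub>2 W\<^sub>2 \<longleftrightarrow>
     (\<forall>V E. simple_graph V E \<longrightarrow> hom_density V E M\<^sub>1 W\<^sub>1 = hom_density V E M\<^sub>2 W\<^sub>2)"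

definition holder_on :: "real \<Rightarrow> 'a::euclidean_space set \<Rightarrow> ('a \<Rightarrow> real) \<Rightarrow> bool" where
  "holder_on \<alpha> D f \<longleftrightarrow> (\<exists>C. \<forall>x\<in>D. \<forall>y\<in>D. \<bar>f x - f y\<bar> \<le> C * norm (x - y) powr \<alpha>)"

abbreviation unit_interval_space :: "real measure" where
  "unit_interval_space \<equiv> lebesgue_on {0..1}"

abbreviation unit_cube_space :: "(real ^ 'd) measure" where
  "unit_cube_space \<equiv> lebesgue_on {x. \<forall>i. x $ i \<in> {0..1}}"

lemma holder_on_1_iff_lipschitz:
  "holder_on 1 D f \<longleftrightarrow> (\<exists>C. C-lipschitz_on D f)"
proof
  assume "holder_on 1 D f"
  then obtain C where C: "\<And>x y. x \<in> D \<Longrightarrow> y \<in> D \<Longrightarrow> \<bar>f x - f y\<bar> \<le> C * norm (x - y)"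
    by (auto simp: holder_on_def)
  have "\<bar>f x - f y\<bar> \<le> \<bar>C\<bar> * norm (x - y)" if "x \<in> D" "y \<in> D" for x y
    using C[OF that] mult_right_mono[OF abs_ge_self[of C], of "norm (x - y)"] by simp
  then have "\<bar>C\<bar>-lipschitz_on D f"
    by (auto simp: lipschitz_on_def dist_norm)
  then show "\<exists>C. C-lipschitz_on D f" ..
qed (auto simp: holder_on_def lipschitz_on_def dist_norm)

lemma unit_cube_eq: "{x :: real ^ 'd. \<forall>i. x $ i \<in> {0..1}} = cbox (\<chi> i. 0) (\<chi> i. 1)"
  by (auto simp: mem_box_cart)

lemma prob_space_unit_interval: "prob_space unit_interval_space"
  by (rule prob_spaceI) (simp add: emeasure_restrict_space space_restrict_space)

lemma prob_space_unit_cube: "prob_space (unit_cube_space :: (real ^ 'd) measure)"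
proof (rule prob_spaceI)
  have "emeasure lborel (cbox (\<chi> i. 0) (\<chi> i. 1) :: (real ^ 'd) set) = 1"
    by (subst emeasure_lborel_cbox)
       (auto simp: Basis_vec_def inner_axis intro!: prod.neutral)
  then show "emeasure unit_cube_space (space (unit_cube_space :: (real ^ 'd) measure)) = 1"
    unfolding unit_cube_eq
    by (simp add: emeasure_restrict_space space_restrict_space)
qed

lemma graphon_scaled_inner:
  fixes a :: real
  assumes "0 < a" "a \<le> 1 / real CARD('d)"
  shows "graphon unit_cube_space (\<lambda>x y :: real ^ 'd. a * (x \<bullet> y))"
proof -
  have m: "(\<lambda>x. x) \<in> borel_measurable (unit_cube_space :: (real ^ 'd) measure)"
    by (intro measurable_restrict_space1 measurable_completion) simp
  have "(\<lambda>(x, y). a * (x \<bullet> y)) \<in> borel_measurable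
          ((unit_cube_space :: (real ^ 'd) measure) \<Otimes>\<^sub>M unit_cube_space)"
    unfolding case_prod_beta
    by (intro borel_measurable_times borel_measurable_const borel_measurable_inner
        measurable_compose[OF measurable_fst m] measurable_compose[OF measurable_snd m])
  moreover have "0 \<le> a * (x \<bullet> y) \<and> a * (x \<bullet> y) \<le> 1"
    if "\<forall>i. x $ i \<in> {0..1}" "\<forall>i. y $ i \<in> {0..1}" for x y :: "real ^ 'd"
  proof -
    have "0 \<le> x \<bullet> y"
      using that by (auto simp: inner_vec_def intro!: sum_nonneg)
    moreover have "x \<bullet> y \<le> (\<Sum>i\<in>(UNIV :: 'd set). 1)"
      unfolding inner_vec_def using that by (intro sum_mono) (auto intro: mult_le_one)
    ultimately show ?thesis
      using assms mult_mono[of a "1 / real CARD('d)" "x \<bullet> y" "real CARD('d)"] by simp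
  qed
  ultimately show ?thesis
    unfolding graphon_def using prob_space_unit_cube
    by (simp add: space_restrict_space inner_commute)
qed

end

theory Submission imports Defs begin

text \<open>
  For a graphon \<open>U\<close> with powers \<open>U\<^sup>k\<close> (composition of kernels), let \<open>D(x, y)\<close> be the squared
  \<open>L\<^sup>2\<close> distance of the rows \<open>U\<^sup>2(x, \<cdot>)\<close> and \<open>U\<^sup>2(y, \<cdot>)\<close>. Since \<open>U\<^sup>4(x, y)\<close> is the density of a path with four
  edges rooted at \<open>x\<close> and \<open>y\<close>, every moment of \<open>D\<close> is a linear combination of densities of simple
  graphs (unions of such paths between two roots), so the integral of \<open>(1 - D)\<^sup>n\<close> is the same for
  equivalent graphons. For the cube, \<open>D(x, y) \<ge> c|x - y|\<^sup>2\<close>, and the integral is at most of order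
  \<open>n\<close> to the power \<open>-d/2\<close>, up to logarithmic factors. If on the interval \<open>D(x, y) \<le> C|x - y|\<close> to
  the power \<open>2\<alpha>\<close>, for \<open>x\<close> in a set of positive measure, then the integral is at least of order \<open>n\<close>
  to the power \<open>-1/(2\<alpha>)\<close>, a contradiction if \<open>\<alpha> > 1/d\<close>.

  A differentiable \<open>U\<close> need not be Lipschitz. However, the cube kernel \<open>W\<close> satisfies
  \<open>W\<^sup>4 - sW\<^sup>3 + pW\<^sup>2 = 0\<close> with \<open>p > 0\<close>; this passes to \<open>U\<close> through cycle densities, and by continuity
  \<open>pU = sU\<^sup>2 - U\<^sup>3\<close> everywhere. Hence the differences of rows of \<open>U\<close> are equicontinuous relative to
  their sup norm and are controlled by their values at finitely many points \<open>t\<close>, where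
  differentiability of \<open>U(\<cdot>, t)\<close> gives a Lipschitz bound on a set of positive measure.
\<close>

lemma abs_mult_le_1: "\<bar>a\<bar> \<le> 1 \<Longrightarrow> \<bar>b\<bar> \<le> 1 \<Longrightarrow> \<bar>a * b\<bar> \<le> 1" for a b :: real
  by (simp add: abs_mult mult_le_one)

lemma abs_prod_le_1: "(\<And>i. i \<in> I \<Longrightarrow> \<bar>f i\<bar> \<le> 1) \<Longrightarrow> \<bar>\<Prod>i\<in>I. f i\<bar> \<le> (1::real)"
  unfolding abs_prod by (intro prod_le_1) auto

section \<open>Powers of a graphon\<close>

text \<open>Indexing: \<open>iter_kernel M U m\<close> is the power \<open>U\<close> to the \<open>m + 1\<close>, a path with \<open>m\<close> inner vertices.\<close>

primrec iter_kernel :: "'a measure \<Rightarrow> ('a \<Rightarrow> 'a \<Rightarrow> real) \<Rightarrow> nat \<Rightarrow> 'a \<Rightarrow> 'a \<Rightarrow> real" where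
  "iter_kernel M U 0 = U"
| "iter_kernel M U (Suc m) = (\<lambda>x y. \<integral>w. U x w * iter_kernel M U m w y \<partial>M)"

text \<open>The expanded form of the squared distance is linear in rooted path densities, which is
  what equivalence can see; \<open>kernel_dist_eq_integral\<close> gives back the integral. Rows of
  U^2 rather than of U are compared because U^2(x, x) would be a double edge, whereas U^4(x, x) is a
  simple 4-cycle through x.\<close>

definition kernel_dist :: "'a measure \<Rightarrow> ('a \<Rightarrow> 'a \<Rightarrow> real) \<Rightarrow> 'a \<Rightarrow> 'a \<Rightarrow> real" where
  "kernel_dist M U x y = iter_kernel M U 3 x x - 2 * iter_kernel M U 3 x y + iter_kernel M U 3 y y"

locale graphon_kernel = prob_space M for M :: "'a measure" +
  fixes U :: "'a \<Rightarrow> 'a \<Rightarrow> real"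
  assumes U_meas: "case_prod U \<in> borel_measurable (M \<Otimes>\<^sub>M M)"
    and U_sym: "\<And>x y. x \<in> space M \<Longrightarrow> y \<in> space M \<Longrightarrow> U x y = U y x"
    and U_nonneg: "\<And>x y. x \<in> space M \<Longrightarrow> y \<in> space M \<Longrightarrow> 0 \<le> U x y"
    and U_le_1: "\<And>x y. x \<in> space M \<Longrightarrow> y \<in> space M \<Longrightarrow> U x y \<le> 1"

lemma graphon_kernel_iff_graphon: "graphon_kernel M U \<longleftrightarrow> graphon M U"
  unfolding graphon_kernel_def graphon_kernel_axioms_def graphon_def by auto

context graphon_kernel
begin

abbreviation "X \<equiv> iter_kernel M U"

lemma integrable_bounded:
  fixes f :: "'a \<Rightarrow> real"
  assumes "f \<in> borel_measurable M" "\<And>x. x \<in> space M \<Longrightarrow> \<bar>f x\<bar> \<le> B"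
  shows "integrable M f"
  using assms by (intro integrable_const_bound[of _ B]) auto

lemma measurable_U [measurable (raw)]:
  assumes "f \<in> N \<rightarrow>\<^sub>M M" "g \<in> N \<rightarrow>\<^sub>M M"
  shows "(\<lambda>z. U (f z) (g z)) \<in> borel_measurable N"
  using measurable_compose[OF measurable_Pair[OF assms] U_meas] by simp

lemma measurable_iter_kernel_aux: "case_prod (X m) \<in> borel_measurable (M \<Otimes>\<^sub>M M)"
proof (induction m)
  case 0
  show ?case using U_meas by simp
next
  case (Suc m)
  have [measurable]: "(\<lambda>z. X m (f z) (g z)) \<in> borel_measurable N"
    if "f \<in> N \<rightarrow>\<^sub>M M" "g \<in> N \<rightarrow>\<^sub>M M" for f g and N :: "(('a \<times> 'a) \<times> 'a) measure"
    using measurable_compose[OF measurable_Pair[OF that] Suc] by simp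
  have "(\<lambda>z. \<integral>w. U (fst z) w * X m w (snd z) \<partial>M) \<in> borel_measurable (M \<Otimes>\<^sub>M M)"
    by measurable
  then show ?case by (simp add: case_prod_beta')
qed

lemma measurable_iter_kernel [measurable (raw)]:
  assumes "f \<in> N \<rightarrow>\<^sub>M M" "g \<in> N \<rightarrow>\<^sub>M M"
  shows "(\<lambda>z. X m (f z) (g z)) \<in> borel_measurable N"
  using measurable_compose[OF measurable_Pair[OF assms] measurable_iter_kernel_aux[of m]] by simp

lemma iter_kernel_bounds:
  assumes "x \<in> space M" "y \<in> space M"
  shows "0 \<le> X m x y \<and> X m x y \<le> 1"
  using assms
proof (induction m arbitrary: x y)
  case 0
  then show ?case using U_nonneg U_le_1 by simp
next
  case (Suc m)
  have *: "0 \<le> U x w * X m w y \<and> U x w * X m w y \<le> 1" if "w \<in> space M" for w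
    using Suc.IH[OF that Suc.prems(2)] U_nonneg[OF Suc.prems(1) that] U_le_1[OF Suc.prems(1) that]
    by (auto intro: mult_le_one)
  have "(\<integral>w. U x w * X m w y \<partial>M) \<le> (\<integral>w. 1 \<partial>M)"
    using Suc.prems * by (intro integral_mono integrable_bounded[of _ 1]) auto
  then show ?case
    using * by (auto intro!: integral_nonneg_AE simp: prob_space)
qed

lemma abs_iter_kernel_le_1:
  "x \<in> space M \<Longrightarrow> y \<in> space M \<Longrightarrow> \<bar>X m x y\<bar> \<le> 1"
  using iter_kernel_bounds by (auto simp: abs_le_iff intro: order_trans[of _ 0])

lemma abs_U_le_1: "x \<in> space M \<Longrightarrow> y \<in> space M \<Longrightarrow> \<bar>U x y\<bar> \<le> 1"
  using abs_iter_kernel_le_1[of x y 0] by simp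

lemma Fubini_bounded:
  fixes f :: "'a \<Rightarrow> 'a \<Rightarrow> real"
  assumes "case_prod f \<in> borel_measurable (M \<Otimes>\<^sub>M M)"
    "\<And>x y. x \<in> space M \<Longrightarrow> y \<in> space M \<Longrightarrow> \<bar>f x y\<bar> \<le> B"
  shows "(\<integral>x. (\<integral>y. f x y \<partial>M) \<partial>M) = (\<integral>y. (\<integral>x. f x y \<partial>M) \<partial>M)"
proof -
  interpret P: pair_prob_space M M ..
  have "integrable (M \<Otimes>\<^sub>M M) (case_prod f)"
    using assms by (intro P.P.integrable_const_bound[of _ B]) (auto simp: space_pair_measure)
  then show ?thesis by (rule P.Fubini_integral[symmetric])
qed

text \<open>A path is cut at one inner vertex: the pieces have i and j inner vertices, and the cut
  vertex accounts for the \<open>Suc\<close>. Edges are peeled off the first piece and the two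
  integrals are exchanged.\<close>

lemma iter_kernel_add:
  assumes "x \<in> space M" "y \<in> space M"
  shows "X (Suc (i + j)) x y = (\<integral>w. X i x w * X j w y \<partial>M)"
  using assms
proof (induction i arbitrary: x)
  case 0
  then show ?case by simp
next
  case (Suc i)
  note [measurable] = Suc.prems
  have "X (Suc (Suc i + j)) x y = (\<integral>w. U x w * X (Suc (i + j)) w y \<partial>M)"
    by simp
  also have "\<dots> = (\<integral>w. (\<integral>v. U x w * X i w v * X j v y \<partial>M) \<partial>M)"
    using Suc by (intro Bochner_Integration.integral_cong) (auto simp: mult.assoc simp del: iter_kernel.simps)
  also have "\<dots> = (\<integral>v. (\<integral>w. U x w * X i w v * X j v y \<partial>M) \<partial>M)"
    using Suc.prems
    by (intro Fubini_bounded[of _ 1] abs_mult_le_1 abs_U_le_1 abs_iter_kernel_le_1) simp_all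
  also have "\<dots> = (\<integral>v. X (Suc i) x v * X j v y \<partial>M)"
    by simp
  finally show ?case .
qed

lemma iter_kernel_sym:
  assumes "x \<in> space M" "y \<in> space M"
  shows "X m x y = X m y x"
  using assms
proof (induction m arbitrary: x y)
  case 0
  then show ?case using U_sym by simp
next
  case (Suc m)
  have "X (Suc m) x y = (\<integral>w. X m y w * X 0 w x \<partial>M)"
    using Suc U_sym by (auto intro!: Bochner_Integration.integral_cong)
  also have "\<dots> = X (Suc m) y x"
    using iter_kernel_add[of y x m 0] Suc.prems by simp
  finally show ?case .
qed

text \<open>By symmetry a product of two rows of U^2 integrates to an entry of U^4, so expanding the
  square produces the three terms of the definition.\<close>

lemma kernel_dist_eq_integral:
  assumes "x \<in> space M" "y \<in> space M"
  shows "kernel_dist M U x y = (\<integral>z. (X 1 x z - X 1 y z)\<^sup>2 \<partial>M)"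
proof -
  have *: "X 3 u v = (\<integral>z. X 1 u z * X 1 v z \<partial>M)" if [measurable]: "u \<in> space M" "v \<in> space M" for u v
  proof -
    have "X 3 u v = (\<integral>z. X 1 u z * X 1 z v \<partial>M)"
      using iter_kernel_add[of u v 1 1] that by (simp add: eval_nat_numeral)
    then show ?thesis using that iter_kernel_sym[of _ v 1]
      by (simp cong: Bochner_Integration.integral_cong del: One_nat_def)
  qed
  note [measurable] = assms
  have int: "integrable M (\<lambda>z. X 1 u z * X 1 v z)" if [measurable]: "u \<in> space M" "v \<in> space M" for u v
    using that by (intro integrable_bounded[of _ 1] abs_mult_le_1 abs_iter_kernel_le_1) simp_all
  have "(X 1 x z - X 1 y z)\<^sup>2 = X 1 x z * X 1 x z - 2 * (X 1 x z * X 1 y z) + X 1 y z * X 1 y z" for z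
    by (simp add: power2_eq_square algebra_simps)
  then show ?thesis
    unfolding kernel_dist_def using assms int by (simp add: * del: One_nat_def)
qed

lemma kernel_dist_bounds:
  assumes "x \<in> space M" "y \<in> space M"
  shows "0 \<le> kernel_dist M U x y \<and> kernel_dist M U x y \<le> 1"
proof -
  note [measurable] = assms
  have *: "(X 1 x z - X 1 y z)\<^sup>2 \<le> 1" if "z \<in> space M" for z
    using iter_kernel_bounds[of x z 1] iter_kernel_bounds[of y z 1] assms that
    by (subst abs_square_le_1) linarith
  have "(\<integral>z. (X 1 x z - X 1 y z)\<^sup>2 \<partial>M) \<le> (\<integral>z. 1 \<partial>M)"
    using * by (intro integral_mono integrable_bounded[of _ 1]) auto
  then show ?thesis
    unfolding kernel_dist_eq_integral[OF assms] by (simp add: prob_space)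
qed

lemma measurable_kernel_dist [measurable (raw)]:
  assumes [measurable]: "f \<in> N \<rightarrow>\<^sub>M M" "g \<in> N \<rightarrow>\<^sub>M M"
  shows "(\<lambda>z. kernel_dist M U (f z) (g z)) \<in> borel_measurable N"
  unfolding kernel_dist_def by measurable

end

section \<open>Path and theta graph densities\<close>

text \<open>The path \<open>p, N, N + 1, \<dots>, N + m - 1, q\<close> with \<open>m\<close> new inner vertices.\<close>

primrec path_edges :: "nat \<Rightarrow> nat \<Rightarrow> nat \<Rightarrow> nat \<Rightarrow> nat set set" where
  "path_edges p q N 0 = {{p, q}}"
| "path_edges p q N (Suc m) = insert {p, N} (path_edges N q (Suc N) m)"

lemma finite_path_edges: "finite (path_edges p q N m)"
  by (induction m arbitrary: p N) auto

lemma path_edges_simple: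
  assumes "p < N" "q < N" "p \<noteq> q \<or> 1 \<le> m"
  shows "path_edges p q N m \<subseteq> {e. e \<subseteq> {..<N + m} \<and> card e = 2}"
  using assms
proof (induction m arbitrary: p N)
  case (Suc m)
  have "path_edges N q (Suc N) m \<subseteq> {e. e \<subseteq> {..<Suc N + m} \<and> card e = 2}"
    using Suc.prems by (intro Suc.IH) auto
  then show ?case using Suc.prems by auto
qed (auto simp: card_2_iff)

text \<open>This makes a new path edge-disjoint from everything built on the older vertices, so that
  products over unions of edge sets factor.\<close>

lemma path_edges_new:
  assumes "e \<in> path_edges p q N m" "1 \<le> m"
  shows "\<not> e \<subseteq> {..<N}"
  using assms
proof (induction m arbitrary: p N)
  case (Suc m)
  show ?case
  proof (cases "e = {p, N} \<or> m = 0")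
    case False
    then have "\<not> e \<subseteq> {..<Suc N}" using Suc by (intro Suc.IH) auto
    then show ?thesis by auto
  qed (use Suc.prems in auto)
qed auto

context graphon_kernel
begin

sublocale PM: product_prob_space "\<lambda>_::nat. M" UNIV ..

lemma integrable_PiM_bounded:
  fixes f :: "(nat \<Rightarrow> 'a) \<Rightarrow> real"
  assumes "f \<in> borel_measurable (PiM I (\<lambda>_. M))" "\<And>x. x \<in> space (PiM I (\<lambda>_. M)) \<Longrightarrow> \<bar>f x\<bar> \<le> B"
  shows "integrable (PiM I (\<lambda>_. M)) f"
proof -
  interpret P: prob_space "PiM I (\<lambda>_. M)"
    by (rule prob_space_PiM) (rule prob_space_axioms)
  show ?thesis using assms by (intro P.integrable_const_bound[of _ B]) auto
qed

lemma space_PiM_component: "x \<in> space (PiM I (\<lambda>_. M)) \<Longrightarrow> i \<in> I \<Longrightarrow> x i \<in> space M"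
  by (auto simp: space_PiM)

lemma edge_weight:
  assumes "i \<noteq> j" "x i \<in> space M" "x j \<in> space M"
  shows "U (x (Min {i, j})) (x (Max {i, j})) = U (x i) (x j)"
  using assms U_sym by (cases "i < j") (auto simp: min_def max_def)

lemma measurable_edge_weight:
  assumes "e \<subseteq> V" "card e = 2"
  shows "(\<lambda>x. U (x (Min e)) (x (Max e))) \<in> borel_measurable (PiM V (\<lambda>_. M))"
proof -
  have "Min e \<in> V" "Max e \<in> V"
    using assms by (auto simp: card_2_iff min_def max_def)
  then show ?thesis by measurable
qed

lemma measurable_edge_weights:
  assumes "E \<subseteq> {e. e \<subseteq> V \<and> card e = 2}"
  shows "(\<lambda>x. \<Prod>e\<in>E. U (x (Min e)) (x (Max e))) \<in> borel_measurable (PiM V (\<lambda>_. M))"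
  using assms by (intro borel_measurable_prod measurable_edge_weight) auto

lemma abs_edge_weights_le_1:
  assumes "E \<subseteq> {e. e \<subseteq> V \<and> card e = 2}" "x \<in> space (PiM V (\<lambda>_. M))"
  shows "\<bar>\<Prod>e\<in>E. U (x (Min e)) (x (Max e))\<bar> \<le> 1"
proof (intro abs_prod_le_1 abs_U_le_1)
  fix e assume "e \<in> E"
  then have "Min e \<in> V" "Max e \<in> V"
    using assms by (auto simp: card_2_iff min_def max_def)
  then show "x (Min e) \<in> space M" "x (Max e) \<in> space M"
    using assms(2) by (auto intro: space_PiM_component)
qed

text \<open>The inner vertices are integrated out one after another. The arbitrary weight
  \<open>G\<close> on the old vertices carries the induction and later holds the rest of the graph.
  For p = q one inner vertex is too few: both path edges would be the same set and be counted once,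
  while U^2(x, x) counts the edge twice.\<close>

lemma integral_PiM_path:
  assumes "p < N" "q < N" "p \<noteq> q \<or> 2 \<le> m"
    and "G \<in> borel_measurable (PiM {..<N} (\<lambda>_. M))"
    and "\<And>x. x \<in> space (PiM {..<N} (\<lambda>_. M)) \<Longrightarrow> \<bar>G x\<bar> \<le> 1"
  shows "(\<integral>x. G (restrict x {..<N}) * (\<Prod>e\<in>path_edges p q N m. U (x (Min e)) (x (Max e)))
            \<partial>PiM {..<N + m} (\<lambda>_. M))
       = (\<integral>x. G x * X m (x p) (x q) \<partial>PiM {..<N} (\<lambda>_. M))"
  using assms
proof (induction m arbitrary: p N G)
  case 0
  show ?case
  proof (intro Bochner_Integration.integral_cong)
    fix x assume x: "x \<in> space (PiM {..<N} (\<lambda>_. M))"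
    then have "restrict x {..<N} = x"
      by (auto simp: space_PiM PiE_restrict)
    then show "G (restrict x {..<N}) * (\<Prod>e\<in>path_edges p q N 0. U (x (Min e)) (x (Max e))) =
          G x * X 0 (x p) (x q)"
      using x 0 by (simp add: edge_weight space_PiM_component del: Min_insert Max_insert)
  qed simp
next
  case (Suc m)
  note [measurable] = Suc.prems(4)
  \<comment> \<open>The weight of the first edge moves into \<open>G\<close>, so the remaining path
    starts at the new vertex N and has the same shape again.\<close>
  define G' where "G' x = G (restrict x {..<N}) * U (x p) (x N)" for x
  have r: "restrict x {..<N} \<in> space (PiM {..<N} (\<lambda>_. M))" if "x \<in> space (PiM {..<Suc N} (\<lambda>_. M))" for x
    using that by (auto simp: space_PiM PiE_def extensional_def)
  have mr [measurable]: "(\<lambda>x. restrict x {..<N}) \<in> PiM {..<Suc N} (\<lambda>_. M) \<rightarrow>\<^sub>M PiM {..<N} (\<lambda>_. M)"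
    by (rule measurable_restrict_subset) auto
  have comp [measurable]: "(\<lambda>x. x i) \<in> PiM {..<Suc N} (\<lambda>_. M) \<rightarrow>\<^sub>M M" if "i < Suc N" for i
    using that by (intro measurable_component_singleton) auto
  have meas': "G' \<in> borel_measurable (PiM {..<Suc N} (\<lambda>_. M))"
    unfolding G'_def
    by (intro borel_measurable_times measurable_compose[OF mr] measurable_U comp Suc.prems) (use Suc.prems in auto)
  have bd': "\<bar>G' x\<bar> \<le> 1" if "x \<in> space (PiM {..<Suc N} (\<lambda>_. M))" for x
    unfolding G'_def using Suc.prems r[OF that] that
    by (intro abs_mult_le_1 abs_U_le_1) (auto intro: space_PiM_component)
  \<comment> \<open>For m = 0 the only other edge is {N, q}, which differs from {p, N} because p and
    q differ in this case. For larger m every later edge contains a vertex beyond N.\<close>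
  have new: "{p, N} \<notin> path_edges N q (Suc N) m"
  proof (cases "m = 0")
    case True
    then show ?thesis using Suc.prems by (auto simp: doubleton_eq_iff)
  next
    case False
    then show ?thesis using path_edges_new[of "{p, N}" N q "Suc N" m] Suc.prems by auto
  qed
  have "(\<integral>x. G (restrict x {..<N}) * (\<Prod>e\<in>path_edges p q N (Suc m). U (x (Min e)) (x (Max e)))
            \<partial>PiM {..<N + Suc m} (\<lambda>_. M))
     = (\<integral>x. G' (restrict x {..<Suc N}) * (\<Prod>e\<in>path_edges N q (Suc N) m. U (x (Min e)) (x (Max e)))
            \<partial>PiM {..<Suc N + m} (\<lambda>_. M))"
  proof (intro Bochner_Integration.integral_cong)
    fix x assume x: "x \<in> space (PiM {..<Suc N + m} (\<lambda>_. M))"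
    have "restrict (restrict x {..<Suc N}) {..<N} = restrict x {..<N}"
      by (auto simp: restrict_def)
    then show "G (restrict x {..<N}) * (\<Prod>e\<in>path_edges p q N (Suc m). U (x (Min e)) (x (Max e))) =
       G' (restrict x {..<Suc N}) * (\<Prod>e\<in>path_edges N q (Suc N) m. U (x (Min e)) (x (Max e)))"
      using new x Suc.prems(1,2)
      by (simp add: G'_def finite_path_edges edge_weight space_PiM_component del: Min_insert Max_insert)
  qed simp
  also have "\<dots> = (\<integral>x. G' x * X m (x N) (x q) \<partial>PiM {..<Suc N} (\<lambda>_. M))"
    using Suc.prems meas' bd' by (intro Suc.IH) auto
  also have "\<dots> = (\<integral>x. G' x * X m (x N) (x q) \<partial>PiM (insert N {..<N}) (\<lambda>_. M))"
    by (simp add: lessThan_Suc)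
  also have "\<dots> = (\<integral>x. (\<integral>y. G' (x(N:=y)) * X m ((x(N:=y)) N) ((x(N:=y)) q) \<partial>M) \<partial>PiM {..<N} (\<lambda>_. M))"
  proof (rule PM.product_integral_insert)
    show "integrable (PiM (insert N {..<N}) (\<lambda>_. M)) (\<lambda>x. G' x * X m (x N) (x q))"
      unfolding lessThan_Suc[symmetric] using Suc.prems
      by (intro integrable_PiM_bounded[of _ _ 1] borel_measurable_times meas' measurable_iter_kernel comp
        abs_mult_le_1 bd' abs_iter_kernel_le_1) (auto intro: space_PiM_component)
  qed auto
  also have "\<dots> = (\<integral>x. G x * X (Suc m) (x p) (x q) \<partial>PiM {..<N} (\<lambda>_. M))"
  proof (intro Bochner_Integration.integral_cong)
    fix x assume x: "x \<in> space (PiM {..<N} (\<lambda>_. M))"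
    have "restrict (x(N:=y)) {..<N} = x" for y
      using x by (auto simp: space_PiM PiE_def extensional_def restrict_def fun_eq_iff)
    then show "(\<integral>y. G' (x(N:=y)) * X m ((x(N:=y)) N) ((x(N:=y)) q) \<partial>M) = G x * X (Suc m) (x p) (x q)"
      using Suc.prems by (simp add: G'_def mult.assoc)
  qed simp
  finally show ?case .
qed

text \<open>The trace of U^(m+1) is a closed path at one root. The bound on m says that the cycle
  has at least three edges; the trace of U^2 is not obtained this way.\<close>

lemma hom_density_cycle:
  assumes "2 \<le> m"
  shows "hom_density {..<Suc m} (path_edges 0 0 1 m) M U = (\<integral>x. X m x x \<partial>M)"
proof -
  have "hom_density {..<Suc m} (path_edges 0 0 1 m) M U = (\<integral>x. X m (x 0) (x 0) \<partial>PiM {..<Suc 0} (\<lambda>_. M))"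
    using integral_PiM_path[of 0 1 0 m "\<lambda>_. 1"] assms by (simp add: hom_density_def)
  also have "{..<Suc 0} = {0}" by auto
  also have "(\<integral>x. X m (x 0) (x 0) \<partial>PiM {0::nat} (\<lambda>_. M)) = (\<integral>x. X m x x \<partial>M)"
    by (rule PM.product_integral_singleton) simp
  finally show ?thesis .
qed

end

lemma simple_graph_cycle: "1 \<le> m \<Longrightarrow> simple_graph {..<Suc m} (path_edges 0 0 1 m)"
  using path_edges_simple[of 0 1 0 m] by (simp add: simple_graph_def)

text \<open>Vertices \<open>0\<close> and \<open>1\<close> are the roots; the \<open>k\<close>-th path joins the roots \<open>p k\<close> and \<open>q k\<close> (possibly equal)
  through the three private vertices \<open>2 + 3k, \<dots>, 4 + 3k\<close>, so that no edge is repeated.\<close>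

primrec theta_edges :: "(nat \<Rightarrow> nat) \<Rightarrow> (nat \<Rightarrow> nat) \<Rightarrow> nat \<Rightarrow> nat set set" where
  "theta_edges p q 0 = {}"
| "theta_edges p q (Suc n) = theta_edges p q n \<union> path_edges (p n) (q n) (2 + 3 * n) 3"

lemma simple_graph_theta:
  assumes "\<And>k. p k < 2" "\<And>k. q k < 2"
  shows "simple_graph {..<2 + 3 * n} (theta_edges p q n)"
proof (induction n)
  case (Suc n)
  have "path_edges (p n) (q n) (2 + 3 * n) 3 \<subseteq> {e. e \<subseteq> {..<2 + 3 * n + 3} \<and> card e = 2}"
    using assms[of n] by (intro path_edges_simple) auto
  then show ?case using Suc unfolding simple_graph_def by fastforce
qed (simp add: simple_graph_def)

context graphon_kernel
begin

text \<open>The last path is integrated out first, with all earlier edges hidden in the weight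
  \<open>G1\<close>. What it leaves depends on the roots only and joins \<open>G\<close>, giving
  \<open>G2\<close>, to which the induction hypothesis applies.\<close>

lemma hom_density_theta_aux:
  assumes p: "\<And>k. p k < 2" and q: "\<And>k. q k < 2"
    and G: "G \<in> borel_measurable (PiM {..<2} (\<lambda>_. M))"
      "\<And>x. x \<in> space (PiM {..<2} (\<lambda>_. M)) \<Longrightarrow> \<bar>G x\<bar> \<le> 1"
  shows "(\<integral>x. G (restrict x {..<2}) * (\<Prod>e\<in>theta_edges p q n. U (x (Min e)) (x (Max e)))
            \<partial>PiM {..<2 + 3 * n} (\<lambda>_. M))
       = (\<integral>x. G x * (\<Prod>k<n. X 3 (x (p k)) (x (q k))) \<partial>PiM {..<2} (\<lambda>_. M))"
  using G
proof (induction n arbitrary: G)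
  case 0
  show ?case
  proof (intro Bochner_Integration.integral_cong)
    fix x assume "x \<in> space (PiM {..<2::nat} (\<lambda>_. M))"
    then have "restrict x {..<2} = x" by (auto simp: space_PiM PiE_restrict)
    then show "G (restrict x {..<2}) * (\<Prod>e\<in>theta_edges p q 0. U (x (Min e)) (x (Max e))) =
       G x * (\<Prod>k<0. X 3 (x (p k)) (x (q k)))" by simp
  qed simp
next
  case (Suc n)
  let ?N = "2 + 3 * n"
  let ?w = "\<lambda>E x. \<Prod>e\<in>E. U (x (Min e)) (x (Max e))"
  have sg: "theta_edges p q n \<subseteq> {e. e \<subseteq> {..<?N} \<and> card e = 2}" "finite (theta_edges p q n)"
    using simple_graph_theta[of p q n] p q finite_subset[of "theta_edges p q n" "Pow {..<?N}"]
    by (auto simp: simple_graph_def)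
  have pq: "p n < ?N" "q n < ?N" using p[of n] q[of n] by auto
  define G1 where "G1 x = G (restrict x {..<2}) * ?w (theta_edges p q n) x" for x
  define G2 where "G2 x = G x * X 3 (x (p n)) (x (q n))" for x
  have mr: "(\<lambda>x. restrict x {..<2}) \<in> PiM {..<?N} (\<lambda>_. M) \<rightarrow>\<^sub>M PiM {..<2} (\<lambda>_. M)"
    by (rule measurable_restrict_subset) auto
  have r: "restrict x {..<2} \<in> space (PiM {..<2} (\<lambda>_. M))" if "x \<in> space (PiM {..<?N} (\<lambda>_. M))" for x
    using that by (auto simp: space_PiM PiE_def extensional_def)
  have m1: "G1 \<in> borel_measurable (PiM {..<?N} (\<lambda>_. M))"
    unfolding G1_def
    by (intro borel_measurable_times measurable_compose[OF mr] measurable_edge_weights Suc.prems sg)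
  have b1: "\<bar>G1 x\<bar> \<le> 1" if "x \<in> space (PiM {..<?N} (\<lambda>_. M))" for x
    unfolding G1_def
    by (rule abs_mult_le_1[OF Suc.prems(2)[OF r[OF that]] abs_edge_weights_le_1[OF sg(1) that]])
  have m2: "G2 \<in> borel_measurable (PiM {..<2} (\<lambda>_. M))"
    unfolding G2_def using p[of n] q[of n]
    by (intro borel_measurable_times Suc.prems measurable_iter_kernel measurable_component_singleton) auto
  have b2: "\<bar>G2 x\<bar> \<le> 1" if "x \<in> space (PiM {..<2} (\<lambda>_. M))" for x
    unfolding G2_def using that p[of n] q[of n]
    by (intro abs_mult_le_1 Suc.prems abs_iter_kernel_le_1) (auto intro: space_PiM_component)
  have disj: "theta_edges p q n \<inter> path_edges (p n) (q n) ?N 3 = {}"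
    using sg path_edges_new[of _ "p n" "q n" ?N 3] by fastforce
  have "(\<integral>x. G (restrict x {..<2}) * ?w (theta_edges p q (Suc n)) x \<partial>PiM {..<2 + 3 * Suc n} (\<lambda>_. M))
      = (\<integral>x. G1 (restrict x {..<?N}) * ?w (path_edges (p n) (q n) ?N 3) x \<partial>PiM {..<?N + 3} (\<lambda>_. M))"
  proof (intro Bochner_Integration.integral_cong)
    fix x :: "nat \<Rightarrow> 'a"
    have 1: "restrict (restrict x {..<?N}) {..<2} = restrict x {..<2}"
      by (auto simp: restrict_def)
    have 2: "?w (theta_edges p q n) (restrict x {..<?N}) = ?w (theta_edges p q n) x"
    proof (intro prod.cong refl)
      fix e assume "e \<in> theta_edges p q n"
      then have "e \<subseteq> {..<?N}" "card e = 2" using sg(1) by auto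
      then have "Min e < ?N" "Max e < ?N" by (auto simp: card_2_iff min_def max_def)
      then show "U (restrict x {..<?N} (Min e)) (restrict x {..<?N} (Max e)) = U (x (Min e)) (x (Max e))"
        by simp
    qed
    show "G (restrict x {..<2}) * ?w (theta_edges p q (Suc n)) x =
        G1 (restrict x {..<?N}) * ?w (path_edges (p n) (q n) ?N 3) x"
      unfolding G1_def 1 2 theta_edges.simps
      by (subst prod.union_disjoint[OF sg(2) finite_path_edges disj]) (simp add: mult.assoc)
  qed (simp add: algebra_simps)
  also have "\<dots> = (\<integral>x. G1 x * X 3 (x (p n)) (x (q n)) \<partial>PiM {..<?N} (\<lambda>_. M))"
    by (rule integral_PiM_path[OF pq _ m1 b1]) auto
  also have "\<dots> = (\<integral>x. G2 (restrict x {..<2}) * ?w (theta_edges p q n) x \<partial>PiM {..<?N} (\<lambda>_. M))"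
    using p[of n] q[of n] by (simp add: G1_def G2_def ac_simps)
  also have "\<dots> = (\<integral>x. G2 x * (\<Prod>k<n. X 3 (x (p k)) (x (q k))) \<partial>PiM {..<2} (\<lambda>_. M))"
    by (rule Suc.IH[OF m2 b2])
  also have "\<dots> = (\<integral>x. G x * (\<Prod>k<Suc n. X 3 (x (p k)) (x (q k))) \<partial>PiM {..<2} (\<lambda>_. M))"
    by (simp add: G2_def ac_simps)
  finally show ?case .
qed

lemma hom_density_theta:
  assumes p: "\<And>k. p k < 2" and q: "\<And>k. q k < 2"
  shows "hom_density {..<2 + 3 * n} (theta_edges p q n) M U
       = (\<integral>x. (\<Prod>k<n. X 3 (x (p k)) (x (q k))) \<partial>PiM {..<2} (\<lambda>_. M))"
  using hom_density_theta_aux[OF assms, of "\<lambda>_. 1" n] by (simp add: hom_density_def)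

lemma integral_PiM_2:
  assumes f: "case_prod f \<in> borel_measurable (M \<Otimes>\<^sub>M M)"
    "\<And>x y. x \<in> space M \<Longrightarrow> y \<in> space M \<Longrightarrow> \<bar>f x y\<bar> \<le> (B::real)"
  shows "(\<integral>x. f (x 0) (x 1) \<partial>PiM {..<2::nat} (\<lambda>_. M)) = (\<integral>x. \<integral>y. f x y \<partial>M \<partial>M)"
proof -
  have m: "(\<lambda>z. f (g z) (h z)) \<in> borel_measurable N" if "g \<in> N \<rightarrow>\<^sub>M M" "h \<in> N \<rightarrow>\<^sub>M M" for g h and N :: "'b measure"
    using measurable_compose[OF measurable_Pair[OF that] f(1)] by simp
  have 2: "{..<2::nat} = insert 1 {0}" by auto
  have int: "integrable (PiM (insert (1::nat) {0}) (\<lambda>_. M)) (\<lambda>x. f (x 0) (x 1))"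
    by (intro integrable_PiM_bounded[of _ _ B] m f measurable_component_singleton)
      (auto intro: space_PiM_component)
  have "(\<integral>x. f (x 0) (x 1) \<partial>PiM (insert (1::nat) {0}) (\<lambda>_. M)) 
     = (\<integral>x. \<integral>y. f ((x(1 := y)) 0) ((x(1 := y)) 1) \<partial>M \<partial>PiM {0::nat} (\<lambda>_. M))"
    using PM.product_integral_insert[of "{0}" 1 "\<lambda>x. f (x 0) (x 1)"] int by simp
  also have "\<dots> = (\<integral>x. (\<lambda>x. \<integral>y. f x y \<partial>M) (x 0) \<partial>PiM {0::nat} (\<lambda>_. M))"
    by simp
  also have "\<dots> = (\<integral>x. \<integral>y. f x y \<partial>M \<partial>M)"
    using f(1) by (intro PM.product_integral_singleton) simp
  finally show ?thesis by (simp only: 2)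
qed

end

section \<open>Moments of the kernel distance and traces of powers\<close>

context graphon_kernel
begin

text \<open>Mixed moments of 1 - D and rooted path densities. Only n = 0 is wanted in the end; the
  product is carried along because expanding one factor 1 - D creates new path factors, so the
  family is closed under this step and reduces to m = 0, a pure theta graph density.\<close>

definition dist_moment :: "nat \<Rightarrow> nat \<Rightarrow> (nat \<Rightarrow> nat) \<Rightarrow> (nat \<Rightarrow> nat) \<Rightarrow> real" where
  "dist_moment m n p q = (\<integral>x. (1 - kernel_dist M U (x 0) (x 1)) ^ m * (\<Prod>k<n. X 3 (x (p k)) (x (q k)))
      \<partial>PiM {..<2::nat} (\<lambda>_. M))"

lemma abs_one_minus_dist_le_1:
  "x \<in> space M \<Longrightarrow> y \<in> space M \<Longrightarrow> \<bar>(1 - kernel_dist M U x y) ^ m\<bar> \<le> 1"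
  using kernel_dist_bounds[of x y] by (auto simp: power_abs intro!: power_le_one)

lemma integrable_dist_moment:
  assumes p: "\<And>k. p k < 2" and q: "\<And>k. q k < 2"
  shows "integrable (PiM {..<2::nat} (\<lambda>_. M))
    (\<lambda>x. (1 - kernel_dist M U (x 0) (x 1)) ^ m * (\<Prod>k<n. X 3 (x (p k)) (x (q k))))"
proof (rule integrable_PiM_bounded[of _ _ 1])
  show "(\<lambda>x. (1 - kernel_dist M U (x 0) (x 1)) ^ m * (\<Prod>k<n. X 3 (x (p k)) (x (q k))))
      \<in> borel_measurable (PiM {..<2} (\<lambda>_. M))"
    using assms
    by (intro borel_measurable_times borel_measurable_power borel_measurable_diff borel_measurable_const
       borel_measurable_prod measurable_iter_kernel measurable_kernel_dist measurable_component_singleton) auto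
  show "\<bar>(1 - kernel_dist M U (x 0) (x 1)) ^ m * (\<Prod>k<n. X 3 (x (p k)) (x (q k)))\<bar> \<le> 1"
    if "x \<in> space (PiM {..<2} (\<lambda>_. M))" for x
    using assms that
    by (intro abs_mult_le_1 abs_prod_le_1 abs_iter_kernel_le_1 abs_one_minus_dist_le_1)
      (auto intro: space_PiM_component)
qed

lemma dist_moment_0:
  assumes "\<And>k. p k < 2" "\<And>k. q k < 2"
  shows "dist_moment 0 n p q = hom_density {..<2 + 3 * n} (theta_edges p q n) M U"
  using hom_density_theta[OF assms] by (simp add: dist_moment_def)

text \<open>One factor 1 - D is replaced by its definition; each of the three terms of D becomes a
  path with index n. The updates at n leave the factors with index below n unchanged.\<close>

lemma dist_moment_Suc:
  assumes p: "\<And>k. p k < 2" and q: "\<And>k. q k < 2"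
  shows "dist_moment (Suc m) n p q = dist_moment m n p q - dist_moment m (Suc n) (p(n := 0)) (q(n := 0))
    + 2 * dist_moment m (Suc n) (p(n := 0)) (q(n := 1)) - dist_moment m (Suc n) (p(n := 1)) (q(n := 1))"
proof -
  let ?D = "\<lambda>x. (1 - kernel_dist M U (x 0) (x 1)) ^ m"
  let ?f = "\<lambda>n p q x. ?D x * (\<Prod>k<n. X 3 (x (p k)) (x (q k)))"
  note int = integrable_dist_moment
  have lin: "(\<integral>x. a x - b x + 2 * c x - d x \<partial>N)
      = (\<integral>x. a x \<partial>N) - (\<integral>x. b x \<partial>N) + 2 * (\<integral>x. c x \<partial>N) - (\<integral>x. d x \<partial>N)"
    if "integrable N a" "integrable N b" "integrable N c" "integrable N d"
    for a b c d :: "(nat \<Rightarrow> 'a) \<Rightarrow> real" and N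
    using that by simp
  have "dist_moment (Suc m) n p q = (\<integral>x. ?f n p q x - ?f (Suc n) (p(n := 0)) (q(n := 0)) x
      + 2 * ?f (Suc n) (p(n := 0)) (q(n := 1)) x - ?f (Suc n) (p(n := 1)) (q(n := 1)) x
      \<partial>PiM {..<2::nat} (\<lambda>_. M))"
    unfolding dist_moment_def
    by (intro Bochner_Integration.integral_cong refl) (simp add: kernel_dist_def algebra_simps)
  also have "\<dots> = dist_moment m n p q - dist_moment m (Suc n) (p(n := 0)) (q(n := 0))
    + 2 * dist_moment m (Suc n) (p(n := 0)) (q(n := 1)) - dist_moment m (Suc n) (p(n := 1)) (q(n := 1))"
    unfolding dist_moment_def using p q by (intro lin int) auto
  finally show ?thesis .
qed

lemma dist_moment_eq_integral:
  "dist_moment m 0 p q = (\<integral>x. \<integral>y. (1 - kernel_dist M U x y) ^ m \<partial>M \<partial>M)"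
  unfolding dist_moment_def
  by (subst integral_PiM_2[of "\<lambda>x y. (1 - kernel_dist M U x y) ^ m" 1, symmetric])
    (auto simp: case_prod_beta' intro!: abs_one_minus_dist_le_1)

definition kernel_trace :: "nat \<Rightarrow> real" where
  "kernel_trace m = (\<integral>x. X m x x \<partial>M)"

lemma square_iter_kernel_sum:
  assumes x: "x \<in> space M"
  shows "(\<integral>y. (\<Sum>i\<in>I. c i * X (i + k) x y)\<^sup>2 \<partial>M)
       = (\<Sum>i\<in>I. \<Sum>j\<in>I. c i * c j * X (Suc (i + j + 2 * k)) x x)"
proof -
  have m: "(\<lambda>y. X i x y * X j x y) \<in> borel_measurable M" for i j
    using x by measurable
  have int: "integrable M (\<lambda>y. X i x y * X j x y)" for i j
    using x m by (intro integrable_bounded[of _ 1] abs_mult_le_1 abs_iter_kernel_le_1) auto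
  have "(\<Sum>i\<in>I. c i * X (i + k) x y)\<^sup>2 = (\<Sum>i\<in>I. \<Sum>j\<in>I. c i * c j * (X (i + k) x y * X (j + k) x y))" for y
    by (simp add: power2_eq_square sum_product ac_simps)
  then have "(\<integral>y. (\<Sum>i\<in>I. c i * X (i + k) x y)\<^sup>2 \<partial>M)
      = (\<Sum>i\<in>I. \<Sum>j\<in>I. c i * c j * (\<integral>y. X (i + k) x y * X (j + k) x y \<partial>M))"
    using int by (simp add: Bochner_Integration.integral_sum)
  also have "\<dots> = (\<Sum>i\<in>I. \<Sum>j\<in>I. c i * c j * X (Suc (i + j + 2 * k)) x x)"
  proof (intro sum.cong refl arg_cong2[of _ _ _ _ "(*)"])
    fix i j
    have "(\<integral>y. X (i + k) x y * X (j + k) x y \<partial>M) = (\<integral>y. X (i + k) x y * X (j + k) y x \<partial>M)"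
      using x by (intro Bochner_Integration.integral_cong refl) (simp add: iter_kernel_sym[of x])
    then show "(\<integral>y. X (i + k) x y * X (j + k) x y \<partial>M) = X (Suc (i + j + 2 * k)) x x"
      using iter_kernel_add[OF x x, of "i + k" "j + k"] 
      by (simp add: ac_simps mult_2_right del: iter_kernel.simps)
  qed
  finally show ?thesis .
qed

text \<open>The squared Hilbert-Schmidt norm of a polynomial in U is a combination of traces of
  powers, all with index at least 2k + 1. For k at least 1 these are cycle densities.\<close>

lemma integral_square_iter_kernel_sum:
  "(\<integral>x. \<integral>y. (\<Sum>i\<in>I. c i * X (i + k) x y)\<^sup>2 \<partial>M \<partial>M)
     = (\<Sum>i\<in>I. \<Sum>j\<in>I. c i * c j * kernel_trace (Suc (i + j + 2 * k)))"
proof -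
  have "integrable M (\<lambda>x. X m x x)" for m
    by (rule integrable_bounded[OF _ abs_iter_kernel_le_1]) auto
  then have "(\<integral>x. (\<Sum>i\<in>I. \<Sum>j\<in>I. c i * c j * X (Suc (i + j + 2 * k)) x x) \<partial>M)
      = (\<Sum>i\<in>I. \<Sum>j\<in>I. c i * c j * kernel_trace (Suc (i + j + 2 * k)))"
    by (simp add: Bochner_Integration.integral_sum kernel_trace_def del: iter_kernel.simps)
  then show ?thesis
    by (simp add: square_iter_kernel_sum cong: Bochner_Integration.integral_cong del: iter_kernel.simps)
qed

end

section \<open>Quantities shared by equivalent graphons\<close>

lemma dist_moment_cong:
  assumes "graphon_kernel M U" "graphon_kernel N W" "equivalent_graphons M U N W"
    and "\<And>k. p k < 2" "\<And>k. q k < 2"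
  shows "graphon_kernel.dist_moment M U m n p q = graphon_kernel.dist_moment N W m n p q"
  using assms(4,5)
proof (induction m arbitrary: n p q)
  case 0
  then show ?case
    using assms(1-3) simple_graph_theta[of p q n]
    by (simp add: graphon_kernel.dist_moment_0 equivalent_graphons_def)
next
  \<comment> \<open>All four terms of \<open>dist_moment_Suc\<close> have exponent m, and the
    updated roots are still 0 or 1.\<close>
  case (Suc m)
  have "graphon_kernel.dist_moment M U m n p q = graphon_kernel.dist_moment N W m n p q"
    using Suc.prems by (rule Suc.IH)
  moreover have "graphon_kernel.dist_moment M U m (Suc n) (p(n := i)) (q(n := j))
        = graphon_kernel.dist_moment N W m (Suc n) (p(n := i)) (q(n := j))" if "i < 2" "j < 2" for i j
    using that Suc.prems by (intro Suc.IH) simp_all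
  ultimately show ?case
    using Suc.prems assms(1-2) by (simp add: graphon_kernel.dist_moment_Suc)
qed

lemma equivalent_graphons_kernel_dist:
  assumes "graphon_kernel M U" "graphon_kernel N W" "equivalent_graphons M U N W"
  shows "(\<integral>x. \<integral>y. (1 - kernel_dist M U x y) ^ n \<partial>M \<partial>M) = (\<integral>x. \<integral>y. (1 - kernel_dist N W x y) ^ n \<partial>N \<partial>N)"
  using dist_moment_cong[OF assms, of "\<lambda>_. 0" "\<lambda>_. 0" n 0] assms(1,2)
  by (simp add: graphon_kernel.dist_moment_eq_integral)

lemma equivalent_graphons_trace:
  assumes "graphon_kernel M U" "graphon_kernel N W" "equivalent_graphons M U N W" "2 \<le> m"
  shows "graphon_kernel.kernel_trace M U m = graphon_kernel.kernel_trace N W m"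
  using assms simple_graph_cycle[of m] graphon_kernel.hom_density_cycle[of M U m] graphon_kernel.hom_density_cycle[of N W m]
  by (simp add: equivalent_graphons_def graphon_kernel.kernel_trace_def)


text \<open>Vanishing of a polynomial in the kernel, in the sense of L^2, passes to equivalent
  graphons. The condition on k keeps every trace index at 3 or above; k = 0 could involve the trace
  of U^2.\<close>

lemma equivalent_graphons_square:
  assumes "graphon_kernel M U" "graphon_kernel N W" "equivalent_graphons M U N W" "1 \<le> k"
  shows "(\<integral>x. \<integral>y. (\<Sum>i\<in>I. c i * iter_kernel M U (i + k) x y)\<^sup>2 \<partial>M \<partial>M)
       = (\<integral>x. \<integral>y. (\<Sum>i\<in>I. c i * iter_kernel N W (i + k) x y)\<^sup>2 \<partial>N \<partial>N)"
  unfolding assms(1,2)[THEN graphon_kernel.integral_square_iter_kernel_sum]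
  using assms(4) by (intro sum.cong refl) (simp add: equivalent_graphons_trace[OF assms(1-3)])

section \<open>The scaled inner product on the cube\<close>

definition coord_sum :: "real ^ 'd \<Rightarrow> real" where "coord_sum x = (\<Sum>i\<in>UNIV. x $ i)"

text \<open>The uncentred second-moment matrix E[w w^T] of a uniform point w of the cube, applied to
  v: each coordinate has variance 1/12, and every pair of coordinates contributes the product 1/4 of
  the means.\<close>

definition cube_cov :: "real ^ 'd \<Rightarrow> real ^ 'd" where
  "cube_cov v = (1/12) *\<^sub>R v + (coord_sum v / 4) *\<^sub>R 1"

lemma nn_integral_unit_power:
  "(\<integral>\<^sup>+ t. ennreal (t ^ n) * indicator {0..1} t \<partial>lborel) = ennreal (1 / (real n + 1))"
proof -
  have d: "DERIV (\<lambda>t. t ^ Suc n / (real n + 1)) t :> t ^ n" for t :: real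
    by (auto intro!: derivative_eq_intros simp: add.commute simp del: power_Suc)
  have "(\<integral>\<^sup>+ t. ennreal (t ^ n) * indicator {0..1} t \<partial>lborel)
      = ennreal (1 ^ Suc n / (real n + 1) - 0 ^ Suc n / (real n + 1))"
    using d by (intro nn_integral_FTC_Icc) auto
  then show ?thesis by simp
qed

lemma prod_Basis_vec:
  fixes f :: "real ^ 'd \<Rightarrow> 'b::comm_monoid_mult"
  shows "(\<Prod>b\<in>Basis. f b) = (\<Prod>k\<in>UNIV. f (axis k (1::real)))"
proof -
  have B: "(Basis :: (real ^ 'd) set) = range (\<lambda>k. axis k 1)" by (auto simp: Basis_vec_def)
  have inj: "inj (\<lambda>k :: 'd. axis k (1::real))" by (auto simp: inj_def axis_eq_axis)
  show ?thesis unfolding B by (subst prod.reindex[OF inj]) simp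
qed

lemma sets_unit_cube [simp, measurable]: "{x :: real ^ 'd. \<forall>i. x $ i \<in> {0..1}} \<in> sets borel"
  unfolding unit_cube_eq by simp

text \<open>The integrand is a monomial, so the integral factors into one-dimensional integrals of
  powers: 1/2 times 1/2 for distinct coordinates, and 1/3 = 1/4 + 1/12 for a repeated one.\<close>

lemma cube_second_moment:
  "(\<integral>w. w $ i * w $ j \<partial>(unit_cube_space :: (real ^ 'd) measure)) = 1/4 + (if i = j then 1/12 else 0)"
proof -
  let ?C = "{x :: real ^ 'd. \<forall>i. x $ i \<in> {0..1}}"
  \<comment> \<open>The exponent of the k-th coordinate in the monomial: 2, 1 or 0. \<open>N\<close>
    is the same exponent indexed by basis vectors, over which Lebesgue measure factors.\<close>
  define n :: "'d \<Rightarrow> nat" where "n k = of_bool (k = i) + of_bool (k = j)" for k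
  define N :: "real ^ 'd \<Rightarrow> nat" where "N b = of_bool (b = axis i 1) + of_bool (b = axis j 1)" for b
  have N: "N (axis k 1) = n k" for k by (simp add: N_def n_def axis_eq_axis)
  have split: "(\<Prod>k\<in>UNIV. w $ k ^ n k) = w $ i * w $ j" for w :: "real ^ 'd"
    by (simp add: n_def power_add prod.distrib of_bool_def if_distrib[of "\<lambda>n. _ ^ n"] cong: if_cong)
  have *: "ennreal (w $ i * w $ j) * indicator ?C w = (\<Prod>b\<in>Basis. ennreal ((w \<bullet> b) ^ N b) * indicator {0..1} (w \<bullet> b))" for w
  proof (cases "w \<in> ?C")
    case True
    then have "(\<Prod>b\<in>Basis. ennreal ((w \<bullet> b) ^ N b) * indicator {0..1} (w \<bullet> b)) = (\<Prod>k\<in>UNIV. ennreal (w $ k ^ n k))"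
      unfolding prod_Basis_vec N by (intro prod.cong) (auto simp: inner_axis)
    also have "\<dots> = ennreal (\<Prod>k\<in>UNIV. w $ k ^ n k)"
      using True by (intro prod_ennreal) auto
    finally show ?thesis using True by (simp add: split)
  next
    case False
    then obtain k where k: "w $ k \<notin> {0..1}" by blast
    then have "(\<Prod>b\<in>Basis. ennreal ((w \<bullet> b) ^ N b) * indicator {0..1} (w \<bullet> b)) = 0"
      unfolding prod_Basis_vec by (intro prod_zero bexI[of _ k]) (simp_all add: inner_axis indicator_def k del: atLeastAtMost_iff)
    then show ?thesis using False by simp
  qed
  have sp: "?C \<inter> space lebesgue \<in> sets lebesgue" by simp
  have "(\<integral>\<^sup>+ w. ennreal (w $ i * w $ j) \<partial>(unit_cube_space :: (real ^ 'd) measure))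
      = (\<integral>\<^sup>+ w. ennreal (w $ i * w $ j) * indicator ?C w \<partial>lebesgue)"
    by (rule nn_integral_restrict_space[OF sp])
  also have "\<dots> = (\<integral>\<^sup>+ w. ennreal (w $ i * w $ j) * indicator ?C w \<partial>lborel)"
    by (intro nn_integral_completion)
  also have "\<dots> = (\<Prod>b\<in>Basis. \<integral>\<^sup>+ t. ennreal (t ^ N b) * indicator {0..1} t \<partial>lborel)"
    unfolding * by (intro nn_integral_lborel_prod) auto
  also have "\<dots> = (\<Prod>k\<in>UNIV. ennreal (1 / (real (n k) + 1)))"
    unfolding nn_integral_unit_power prod_Basis_vec N ..
  also have "\<dots> = ennreal (\<Prod>k\<in>UNIV. 1 / (real (n k) + 1))"
    by (intro prod_ennreal) auto
  also have "(\<Prod>k\<in>UNIV. 1 / (real (n k) + 1)) = 1/4 + (if i = j then 1/12 else 0)"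
  proof (cases "i = j")
    case True
    then have "(\<Prod>k\<in>UNIV. 1 / (real (n k) + 1)) = (\<Prod>k\<in>UNIV. if k = i then 1/3 else 1)"
      by (intro prod.cong) (auto simp: n_def)
    then show ?thesis using True by simp
  next
    case False
    then have "(\<Prod>k\<in>UNIV. 1 / (real (n k) + 1)) = (\<Prod>k\<in>UNIV. (if k = i then 1/2 else 1) * (if k = j then 1/2 else 1))"
      by (intro prod.cong) (auto simp: n_def)
    then show ?thesis using False by (simp add: prod.distrib)
  qed
  finally have nn: "(\<integral>\<^sup>+ w. ennreal (w $ i * w $ j) \<partial>(unit_cube_space :: (real ^ 'd) measure))
      = ennreal (1/4 + (if i = j then 1/12 else 0))" .
  show ?thesis
    by (subst integral_eq_nn_integral, unfold nn)
      (auto intro!: measurable_restrict_space1 measurable_completion AE_I2)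
qed

context
  fixes a :: real and W :: "real ^ 'd \<Rightarrow> real ^ 'd \<Rightarrow> real"
  assumes a: "0 < a" "a \<le> 1 / real CARD('d)"
    and W: "W = (\<lambda>x y. a * (x \<bullet> y))"
begin

interpretation graphon_kernel unit_cube_space W
  unfolding graphon_kernel_iff_graphon W by (rule graphon_scaled_inner[OF a])

lemma cube_inner_integral:
  fixes v y :: "real ^ 'd"
  shows "(\<integral>w. (v \<bullet> w) * (w \<bullet> y) \<partial>unit_cube_space) = v \<bullet> cube_cov y"
proof -
  have m: "(\<lambda>w. w $ i * w $ j) \<in> borel_measurable (unit_cube_space :: (real ^ 'd) measure)" for i j
    by (intro measurable_restrict_space1 measurable_completion) simp
  have int: "integrable unit_cube_space (\<lambda>w :: real ^ 'd. w $ i * w $ j)" for i j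
    by (intro integrable_bounded[OF m, of _ _ 1] abs_mult_le_1) (auto simp: abs_le_iff intro: order_trans[of _ 0])
  have "(\<integral>w. (v \<bullet> w) * (w \<bullet> y) \<partial>unit_cube_space)
      = (\<integral>w. (\<Sum>i\<in>UNIV. \<Sum>j\<in>UNIV. v $ i * y $ j * (w $ i * w $ j)) \<partial>(unit_cube_space :: (real ^ 'd) measure))"
    by (simp add: inner_vec_def sum_product ac_simps)
  also have "\<dots> = (\<Sum>i\<in>UNIV. \<Sum>j\<in>UNIV. v $ i * y $ j * (1/4 + (if i = j then 1/12 else 0)))"
    using int by (simp add: Bochner_Integration.integral_sum cube_second_moment del: atLeastAtMost_iff)
  also have "\<dots> = (\<Sum>i\<in>UNIV. \<Sum>j\<in>UNIV. v $ i * y $ j / 4 + (if i = j then v $ i * y $ j / 12 else 0))"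
    by (intro sum.cong refl) simp
  also have "\<dots> = v \<bullet> cube_cov y"
    by (simp add: inner_vec_def cube_cov_def coord_sum_def ring_distribs sum.distrib sum_distrib_left
        sum_divide_distrib)
  finally show ?thesis .
qed

text \<open>Integrating over an inner vertex inserts the second-moment matrix between the two
  neighbouring vectors, so powers of the kernel reduce to powers of a d by d matrix.\<close>

lemma iter_kernel_inner: "iter_kernel unit_cube_space W m x y = a ^ Suc m * (x \<bullet> (cube_cov ^^ m) y)"
proof (induction m arbitrary: x)
  case 0
  then show ?case by (simp add: W)
next
  case (Suc m)
  have "iter_kernel unit_cube_space W (Suc m) x y
      = (\<integral>w. a ^ Suc (Suc m) * ((x \<bullet> w) * (w \<bullet> (cube_cov ^^ m) y)) \<partial>unit_cube_space)"
    unfolding iter_kernel.simps Suc by (intro Bochner_Integration.integral_cong) (simp_all add: W ac_simps)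
  also have "\<dots> = a ^ Suc (Suc m) * (x \<bullet> (cube_cov ^^ Suc m) y)"
    by (simp add: cube_inner_integral del: atLeastAtMost_iff)
  finally show ?case .
qed

lemma coord_sum_simps:
  "coord_sum (x + y) = coord_sum x + coord_sum y" "coord_sum (c *\<^sub>R x) = c * coord_sum x"
  "coord_sum (1 :: real ^ 'd) = real CARD('d)" "x \<bullet> 1 = coord_sum x" "1 \<bullet> x = coord_sum x"
  for x y :: "real ^ 'd"
  by (simp_all add: coord_sum_def sum.distrib sum_distrib_left inner_vec_def)

text \<open>The second-moment matrix has eigenvalue 1/12 on vectors of coordinate sum 0 and 1/12 +
  d/4 on constant vectors. Their sum 1/6 + d/4 and product 1/144 + d/48 are the coefficients of its
  annihilating quadratic. The relation is taken between the second, third and fourth powers, the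
  range in which it can be transferred by cycle densities.\<close>

lemma cube_kernel_relation:
  defines "d \<equiv> real CARD('d)"
  shows "iter_kernel unit_cube_space W 3 x y - a * (1/6 + d/4) * iter_kernel unit_cube_space W 2 x y
      + a\<^sup>2 * (1/144 + d/48) * iter_kernel unit_cube_space W 1 x y = 0"
  unfolding iter_kernel_inner
  by (simp add: eval_nat_numeral cube_cov_def coord_sum_simps inner_simps d_def) (simp add: field_simps)

text \<open>D(x, y) is a^4 times the quadratic form of the cubed second-moment matrix at x - y, and
  the eigenvalues of that matrix are at least 1/12, with 12^3 = 1728.\<close>

lemma cube_kernel_dist_ge:
  "kernel_dist unit_cube_space W x y \<ge> a ^ 4 / 1728 * (norm (x - y))\<^sup>2"
proof -
  define d where "d = real CARD('d)"
  define g where "g = 1/576 + (1/48 + (d/4 + 1/12) / 4) * (d/4 + 1/12)"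
  have K: "iter_kernel unit_cube_space W 3 u v = a ^ 4 * (u \<bullet> v / 1728 + g * coord_sum u * coord_sum v)" for u v
    unfolding iter_kernel_inner
    by (simp add: eval_nat_numeral cube_cov_def coord_sum_simps inner_simps g_def flip: d_def) (simp add: field_simps)
  have n: "(norm (x - y))\<^sup>2 = x \<bullet> x - 2 * (x \<bullet> y) + y \<bullet> y"
    by (simp add: power2_norm_eq_inner inner_simps inner_commute)
  have "kernel_dist unit_cube_space W x y
      = a ^ 4 * ((norm (x - y))\<^sup>2 / 1728 + g * (coord_sum x - coord_sum y)\<^sup>2)"
    unfolding kernel_dist_def K n by (simp add: power2_eq_square field_simps)
  also have "\<dots> \<ge> a ^ 4 * ((norm (x - y))\<^sup>2 / 1728 + 0)"
    using a by (intro mult_left_mono add_left_mono) (auto simp: g_def d_def)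
  finally show ?thesis by simp
qed

text \<open>Outside the ball of radius r around x, (1 - D)^n is at most exp(-nD), which the
  quadratic lower bound on D controls; inside, the integrand is at most 1 and the ball has volume of
  order r^d. The radius stays free and is tuned to n later.\<close>

lemma cube_integral_dist_le:
  assumes "0 \<le> r"
  shows "(\<integral>x. \<integral>y. (1 - kernel_dist unit_cube_space W x y) ^ n \<partial>unit_cube_space \<partial>unit_cube_space)
     \<le> exp (- (real n * (a ^ 4 / 1728 * r\<^sup>2))) + unit_ball_vol (real CARD('d)) * r ^ CARD('d)"
    (is "_ \<le> ?B")
proof -
  let ?C = "{x :: real ^ 'd. \<forall>i. x $ i \<in> {0..1}}"
  let ?D = "kernel_dist unit_cube_space W"
  let ?e = "exp (- (real n * (a ^ 4 / 1728 * r\<^sup>2)))"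
  have inner: "(\<integral>y. (1 - ?D x y) ^ n \<partial>unit_cube_space) \<le> ?B" if x: "x \<in> space unit_cube_space" for x
  proof -
    note [measurable] = x
    have pt: "(1 - ?D x y) ^ n \<le> ?e + indicator (cball x r) y" if y: "y \<in> space unit_cube_space" for y
    proof (cases "y \<in> cball x r")
      case True
      then have "(1 - ?D x y) ^ n \<le> 1"
        using abs_one_minus_dist_le_1[OF x y, of n] by simp
      then show ?thesis using True by (simp add: add_increasing)
    next
      case False
      then have "r\<^sup>2 \<le> (norm (x - y))\<^sup>2"
        using assms by (intro power_mono) (auto simp: dist_norm)
      then have "a ^ 4 / 1728 * r\<^sup>2 \<le> ?D x y"
        using a by (intro order_trans[OF _ cube_kernel_dist_ge] mult_left_mono) auto
      moreover have "(1 - ?D x y) ^ n \<le> exp (- ?D x y) ^ n"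
        using kernel_dist_bounds[OF x y] exp_ge_add_one_self[of "- ?D x y"] by (intro power_mono) auto
      moreover have "exp (- ?D x y) ^ n = exp (- (real n * ?D x y))"
        by (simp add: exp_of_nat_mult[symmetric])
      ultimately have "(1 - ?D x y) ^ n \<le> ?e"
        by (smt (verit) exp_le_cancel_iff mult_left_mono of_nat_0_le_iff)
      then show ?thesis using False by simp
    qed
    have ms: "cball x r \<inter> ?C \<in> sets unit_cube_space"
      by (auto simp: sets_restrict_space intro!: image_eqI[of _ _ "cball x r"])
    have bm: "(indicator (cball x r) :: _ \<Rightarrow> real) \<in> borel_measurable (unit_cube_space :: (real ^ 'd) measure)"
      by (intro measurable_restrict_space1 measurable_completion borel_measurable_indicator) simp
    have mD: "(\<lambda>y. (1 - ?D x y) ^ n) \<in> borel_measurable unit_cube_space"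
      by measurable
    have intD: "integrable unit_cube_space (\<lambda>y. (1 - ?D x y) ^ n)"
      by (rule integrable_bounded[OF mD abs_one_minus_dist_le_1[OF x]])
    have intI: "integrable unit_cube_space (indicator (cball x r) :: _ \<Rightarrow> real)"
      by (rule integrable_bounded[OF bm, of 1]) (simp add: indicator_def)
    have "(\<integral>y. (1 - ?D x y) ^ n \<partial>unit_cube_space) \<le> (\<integral>y. ?e + indicator (cball x r) y \<partial>unit_cube_space)"
      by (intro integral_mono pt intD Bochner_Integration.integrable_add integrable_const intI)
    also have "\<dots> = ?e + (\<integral>y. indicator (cball x r) y \<partial>unit_cube_space)"
      by (subst Bochner_Integration.integral_add[OF integrable_const intI]) (simp only: lebesgue_integral_const prob_space scaleR_one)
    also have "(\<integral>y. indicator (cball x r) y \<partial>unit_cube_space) = measure unit_cube_space (cball x r \<inter> ?C)"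
      by simp
    also have "\<dots> = measure lebesgue (cball x r \<inter> ?C)"
      by (subst measure_restrict_space) auto
    also have "\<dots> \<le> measure lebesgue (cball x r)"
      by (intro measure_mono_fmeasurable) auto
    also have "\<dots> = unit_ball_vol (real CARD('d)) * r ^ CARD('d)"
      using content_cball[OF assms, of x] by simp
    finally show ?thesis by simp
  qed
  have "(\<integral>x. \<integral>y. (1 - ?D x y) ^ n \<partial>unit_cube_space \<partial>unit_cube_space) \<le> (\<integral>x. ?B \<partial>(unit_cube_space :: (real ^ 'd) measure))"
  proof (intro integral_mono inner)
    show "integrable unit_cube_space (\<lambda>x. \<integral>y. (1 - ?D x y) ^ n \<partial>unit_cube_space)"
    proof (rule integrable_bounded[of _ ?B])
      show "\<bar>\<integral>y. (1 - ?D x y) ^ n \<partial>unit_cube_space\<bar> \<le> ?B" if "x \<in> space unit_cube_space" for x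
        using inner[OF that] kernel_dist_bounds[OF that]
        by (subst abs_of_nonneg) (auto intro!: integral_nonneg_AE AE_I2)
    qed measurable
  qed (rule integrable_const)
  also have "\<dots> = ?B" by (simp only: lebesgue_integral_const prob_space scaleR_one)
  finally show ?thesis .
qed

end

section \<open>Graphons on the unit interval\<close>

text \<open>For higher powers the difference of rows is integrated against a kernel bounded by 1 on
  a probability space, so the sup distance of two rows does not grow.\<close>

lemma (in graphon_kernel) iter_kernel_diff_le:
  assumes "x \<in> space M" "x' \<in> space M" "y \<in> space M"
    and B: "\<And>w. w \<in> space M \<Longrightarrow> \<bar>U x w - U x' w\<bar> \<le> B"
  shows "\<bar>X m x y - X m x' y\<bar> \<le> B"
proof (cases m)
  case 0
  then show ?thesis using assms by simp
next
  case (Suc k)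
  note [measurable] = assms(1-3)
  have int: "integrable M (\<lambda>w. U v w * X k w y)" if [measurable]: "v \<in> space M" for v
    using that assms(3) by (intro integrable_bounded[of _ 1] abs_mult_le_1 abs_U_le_1 abs_iter_kernel_le_1) auto
  have "\<bar>X m x y - X m x' y\<bar> = \<bar>\<integral>w. U x w * X k w y - U x' w * X k w y \<partial>M\<bar>"
    using int[OF assms(1)] int[OF assms(2)] by (simp add: Suc)
  also have "\<dots> \<le> (\<integral>w. \<bar>U x w * X k w y - U x' w * X k w y\<bar> \<partial>M)"
    by (rule integral_abs_bound)
  also have "\<dots> \<le> (\<integral>w. B \<partial>M)"
  proof (rule integral_mono)
    show "integrable M (\<lambda>w. \<bar>U x w * X k w y - U x' w * X k w y\<bar>)" "integrable M (\<lambda>w. B)"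
      using int[OF assms(1)] int[OF assms(2)] by simp_all
    fix w assume w: "w \<in> space M"
    have "\<bar>U x w * X k w y - U x' w * X k w y\<bar> = \<bar>U x w - U x' w\<bar> * \<bar>X k w y\<bar>"
      unfolding left_diff_distrib[symmetric] abs_mult ..
    also have "\<dots> \<le> B * 1"
      using B[OF w] abs_iter_kernel_le_1[OF w assms(3), of k] by (intro mult_mono) auto
    finally show "\<bar>U x w * X k w y - U x' w * X k w y\<bar> \<le> B" by simp
  qed
  finally show ?thesis by (simp add: prob_space)
qed

lemma (in graphon_kernel) kernel_dist_le:
  assumes xy: "x \<in> space M" "y \<in> space M"
    and B: "\<And>z. z \<in> space M \<Longrightarrow> \<bar>U x z - U y z\<bar> \<le> B"
  shows "kernel_dist M U x y \<le> B\<^sup>2"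
proof -
  note [measurable] = xy
  have "(\<integral>z. (X 1 x z - X 1 y z)\<^sup>2 \<partial>M) \<le> (\<integral>z. B\<^sup>2 \<partial>M)"
  proof (intro integral_mono integrable_const)
    show *: "(X 1 x z - X 1 y z)\<^sup>2 \<le> B\<^sup>2" if "z \<in> space M" for z
    proof -
      have "\<bar>X 1 x z - X 1 y z\<bar> \<le> B"
        by (rule iter_kernel_diff_le[OF xy that]) (rule B)
      then have "\<bar>X 1 x z - X 1 y z\<bar>\<^sup>2 \<le> B\<^sup>2" by (rule power_mono) simp
      then show ?thesis by (simp only: power2_abs)
    qed
    show "integrable M (\<lambda>z. (X 1 x z - X 1 y z)\<^sup>2)"
      by (rule integrable_bounded[of _ "B\<^sup>2"]) (measurable, simp del: One_nat_def add: *)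
  qed
  then show ?thesis by (simp add: kernel_dist_eq_integral[OF xy] prob_space)
qed

context
  fixes U :: "real \<Rightarrow> real \<Rightarrow> real"
  assumes U: "graphon unit_interval_space U"
begin

interpretation graphon_kernel unit_interval_space U
  using U by (simp add: graphon_kernel_iff_graphon)

text \<open>Where D is at most 1/(2n), Bernoulli's inequality gives (1 - D)^n at least 1/2. This
  holds for all x in A and all y within r of x.\<close>

lemma interval_integral_dist_ge:
  assumes A: "A \<in> sets lebesgue" "A \<subseteq> {0..1}" and n: "0 < n" and r: "0 \<le> r" "r \<le> 1/2"
    and D: "\<And>x y. x \<in> A \<Longrightarrow> y \<in> {0..1} \<Longrightarrow> \<bar>x - y\<bar> \<le> r \<Longrightarrow> kernel_dist unit_interval_space U x y \<le> 1 / (2 * real n)"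
  shows "measure lebesgue A * r / 2
     \<le> (\<integral>x. \<integral>y. (1 - kernel_dist unit_interval_space U x y) ^ n \<partial>unit_interval_space \<partial>unit_interval_space)"
proof -
  let ?D = "kernel_dist unit_interval_space U"
  let ?I = "unit_interval_space"
  have mA: "A \<in> sets ?I" using A by (simp add: sets_restrict_space_iff)
  have pos: "0 \<le> (1 - ?D x y) ^ n" if "x \<in> space ?I" "y \<in> space ?I" for x y
    using kernel_dist_bounds[OF that] by simp
  have ge: "1/2 \<le> (1 - ?D x y) ^ n" if "x \<in> A" "y \<in> {0..1}" "\<bar>x - y\<bar> \<le> r" for x y
  proof -
    have xy: "x \<in> space ?I" "y \<in> space ?I" using that A by auto
    have "1/2 \<le> 1 + real n * (- ?D x y)"
      using D[OF that] n by (simp add: field_simps)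
    also have "\<dots> \<le> (1 + (- ?D x y)) ^ n"
      using kernel_dist_bounds[OF xy] by (intro Bernoulli_inequality) auto
    finally show ?thesis by simp
  qed
  have inner: "indicator A x * (r / 2) \<le> (\<integral>y. (1 - ?D x y) ^ n \<partial>?I)" if x: "x \<in> space ?I" for x
  proof (cases "x \<in> A")
    case False
    then show ?thesis using pos[OF x] by (auto intro!: integral_nonneg_AE AE_I2)
  next
    case True
    note [measurable] = x
    \<comment> \<open>A one-sided interval of length r at x, pointing away from the nearer endpoint;
      it stays inside [0, 1] because r is at most 1/2.\<close>
    define J where "J = (if x \<le> 1/2 then {x..x + r} else {x - r..x})"
    have J: "J \<subseteq> {0..1}" "\<And>y. y \<in> J \<Longrightarrow> \<bar>x - y\<bar> \<le> r"
      using x r by (auto simp: J_def split: if_splits)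
    have mJ: "J \<in> sets ?I" using J(1) by (simp add: sets_restrict_space_iff J_def)
    have "indicator A x * (r / 2) = r / 2" using True by simp
    also have "\<dots> = measure lebesgue J / 2" using r by (simp add: J_def)
    also have "measure lebesgue J = measure ?I J"
      using J by (subst measure_restrict_space) (auto simp: J_def)
    also have "measure ?I J / 2 = (\<integral>y. indicator J y / 2 \<partial>?I)"
      using J by (simp add: Int_absorb2)
    also have "\<dots> \<le> (\<integral>y. (1 - ?D x y) ^ n \<partial>?I)"
    proof (intro integral_mono)
      show "integrable ?I (\<lambda>y. indicator J y / 2 :: real)"
        using mJ by (intro integrable_bounded[of _ 1]) (auto simp: indicator_def)
      have "(\<lambda>y. (1 - ?D x y) ^ n) \<in> borel_measurable ?I" by measurable
      then show "integrable ?I (\<lambda>y. (1 - ?D x y) ^ n)"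
        by (rule integrable_bounded[OF _ abs_one_minus_dist_le_1[OF x]])
      show "indicator J y / 2 \<le> (1 - ?D x y) ^ n" if "y \<in> space ?I" for y
        using ge[OF True _ J(2)] pos[OF x that] that by (cases "y \<in> J") simp_all
    qed
    finally show ?thesis .
  qed
  have "measure lebesgue A * r / 2 = measure ?I A * (r / 2)"
    using A by (subst measure_restrict_space) auto
  also have "\<dots> = (\<integral>x. indicator A x * (r / 2) \<partial>?I)"
    using A by (simp add: Int_absorb2)
  also have "\<dots> \<le> (\<integral>x. \<integral>y. (1 - ?D x y) ^ n \<partial>?I \<partial>?I)"
  proof (intro integral_mono inner)
    show "integrable ?I (\<lambda>x. indicator A x * (r / 2))"
      using mA r by (intro integrable_bounded[of _ 1]) (auto simp: indicator_def)
    show "integrable ?I (\<lambda>x. \<integral>y. (1 - ?D x y) ^ n \<partial>?I)"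
    proof (rule integrable_bounded[of _ 1])
      show "\<bar>\<integral>y. (1 - ?D x y) ^ n \<partial>?I\<bar> \<le> 1" if x: "x \<in> space ?I" for x
      proof -
        note [measurable] = x
        have "(\<lambda>y. (1 - ?D x y) ^ n) \<in> borel_measurable ?I" by measurable
        then have int: "integrable ?I (\<lambda>y. (1 - ?D x y) ^ n)"
          by (rule integrable_bounded[OF _ abs_one_minus_dist_le_1[OF x]])
        have "\<bar>\<integral>y. (1 - ?D x y) ^ n \<partial>?I\<bar> \<le> (\<integral>y. 1 \<partial>?I)"
          by (intro integral_abs_bound[THEN order_trans] integral_mono integrable_abs int
            abs_one_minus_dist_le_1[OF x] integrable_const)
        also have "\<dots> = 1" by (simp only: lebesgue_integral_const prob_space scaleR_one)
        finally show ?thesis .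
      qed
    qed measurable
  qed
  finally show ?thesis .
qed

end

section \<open>Comparison of the two decay rates and the Hoelder case\<close>

lemma decay_comparison:
  fixes b c K C :: real and d :: nat
  assumes "0 < b" "2 * b < real d" "0 < c" "0 < C"
    and N: "\<And>n r. n \<ge> N \<Longrightarrow> 0 \<le> r \<Longrightarrow> C * real n powr (- b) \<le> exp (- (real n * (c * r\<^sup>2))) + K * r ^ d"
  shows False
proof -
  \<comment> \<open>The radius will be n^(e - 1/2). A positive e makes the exponential term exp(-c
    n^(2e)) smaller than every power of n. Half of the slack is spent, d * e = (d/2 - b)/2, so that
    after multiplication by n^b the volume term still has the negative exponent
    \<open>k\<close>.\<close>
  define e where "e = (real d / 2 - b) / (2 * real d)"
  have d: "real d > 0" using assms by linarith
  have e: "0 < e" using assms d by (simp add: e_def)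
  define k where "k = b + real d * (e - 1/2)"
  have k: "k < 0" using assms d by (simp add: k_def e_def field_simps)
  have le: "C \<le> real n powr b * exp (- c * real n powr (2 * e)) + K * real n powr k" if n: "n \<ge> max N 1" for n
  proof -
    let ?r = "real n powr (e - 1/2)"
    have n0: "real n > 0" using n by simp
    have 1: "?r\<^sup>2 = real n powr (2 * e - 1)" 
      using n0 by (simp add: powr_power algebra_simps)
    have 2: "real n * (c * ?r\<^sup>2) = c * real n powr (2 * e)"
      unfolding 1 using n0 by (simp add: powr_diff)
    have 3: "?r ^ d = real n powr (real d * (e - 1/2))"
      using n0 by (simp add: powr_power mult.commute)
    have "C * real n powr (- b) \<le> exp (- (real n * (c * ?r\<^sup>2))) + K * ?r ^ d"
      using n by (intro N) auto
    then have "real n powr b * (C * real n powr (- b)) \<le> real n powr b * (exp (- (c * real n powr (2 * e))) + K * real n powr (real d * (e - 1/2)))"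
      unfolding 2 3 by (intro mult_left_mono) auto
    moreover have "real n powr b * (C * real n powr (- b)) = C"
      using n0 by (simp add: powr_minus field_simps)
    moreover have "real n powr k = real n powr b * real n powr (real d * (e - 1/2))"
      by (simp add: k_def powr_add)
    ultimately show ?thesis
      by (simp only: distrib_left mult_minus_left) (simp only: mult.left_commute)
  qed
  \<comment> \<open>With this j, n^b is at most (n^(2e))^j, and the limit reduces to that of t^j /
    exp t with t = c n^(2e).\<close>
  obtain j :: nat where j: "b / (2 * e) \<le> real j" using real_arch_simple by blast
  let ?t = "\<lambda>n. c * real n powr (2 * e)"
  have "(\<lambda>n. real n powr b * exp (- c * real n powr (2 * e))) \<longlonglongrightarrow> 0"
  proof (rule tendsto_sandwich[OF _ _ tendsto_const])
    have "filterlim (\<lambda>n. real n powr (2 * e)) at_top sequentially"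
      unfolding filterlim_at_top_gt[of _ _ 0]
    proof safe
      fix Z :: real assume Z: "0 < Z"
      show "\<forall>\<^sub>F n in sequentially. Z \<le> real n powr (2 * e)"
        using eventually_ge_at_top[of "nat \<lceil>Z powr (1 / (2 * e))\<rceil>"]
      proof eventually_elim
        case (elim n)
        then have "Z powr (1 / (2 * e)) \<le> real n" by linarith
        then have "(Z powr (1 / (2 * e))) powr (2 * e) \<le> real n powr (2 * e)"
          using e by (intro powr_mono2) auto
        then show ?case using e Z by (simp add: powr_powr)
      qed
    qed
    then have "filterlim ?t at_top sequentially"
      using assms(3) by (intro filterlim_tendsto_pos_mult_at_top[OF tendsto_const])
    then have "(\<lambda>n. ?t n ^ j / exp (?t n)) \<longlonglongrightarrow> 0"
      by (rule filterlim_compose[OF tendsto_power_div_exp_0])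
    then show "(\<lambda>n. (1 / c) ^ j * (?t n ^ j / exp (?t n))) \<longlonglongrightarrow> 0"
      by (rule tendsto_mult_right_zero)
    show "\<forall>\<^sub>F n in sequentially. real n powr b * exp (- c * real n powr (2 * e)) \<le> (1 / c) ^ j * (?t n ^ j / exp (?t n))"
      using eventually_ge_at_top[of 1]
    proof eventually_elim
      case (elim n)
      have "real n powr b \<le> real n powr (2 * e * real j)"
        using elim j e by (intro powr_mono) (auto simp: field_simps)
      also have "\<dots> = (real n powr (2 * e)) ^ j"
        using elim by (simp add: powr_power mult.commute)
      also have "\<dots> = (1 / c) ^ j * ?t n ^ j"
        using assms(3) by (simp add: power_mult_distrib[symmetric])
      finally show ?case
        by (simp add: exp_minus field_simps)
    qed
  qed auto
  moreover have "(\<lambda>n. K * real n powr k) \<longlonglongrightarrow> K * 0"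
    using k by (intro tendsto_mult tendsto_const tendsto_neg_powr filterlim_real_sequentially)
  ultimately have "(\<lambda>n. real n powr b * exp (- c * real n powr (2 * e)) + K * real n powr k) \<longlonglongrightarrow> 0"
    by (auto intro: tendsto_add_zero)
  then have "C \<le> 0"
    by (rule LIMSEQ_le_const) (use le in blast)
  then show False using assms by simp
qed

text \<open>The common contradiction of both cases: the bound on D need only hold for x in a set A
  of positive measure, which is [0, 1] for Hoelder graphons and a smaller set for differentiable
  ones.\<close>

lemma equivalent_cube_interval_dist_False:
  fixes a :: real and W :: "real ^ 'd \<Rightarrow> real ^ 'd \<Rightarrow> real"
  assumes a: "0 < a" "a \<le> 1 / real CARD('d)" and W: "W = (\<lambda>x y. a * (x \<bullet> y))"
    and U: "graphon unit_interval_space U" and eq: "equivalent_graphons unit_cube_space W unit_interval_space U"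
    and \<alpha>: "1 / real CARD('d) < \<alpha>"
    and A: "A \<in> sets lebesgue" "A \<subseteq> {0..1}" "0 < measure lebesgue A" and C: "0 < C"
    and D: "\<And>x y. x \<in> A \<Longrightarrow> y \<in> {0..1} \<Longrightarrow>
      kernel_dist unit_interval_space U x y \<le> C * \<bar>x - y\<bar> powr (2 * \<alpha>)"
  shows False
proof -
  \<comment> \<open>The lower bound decays like n^(-b), the upper bound almost like n^(-d/2); the
    condition on \<alpha> says exactly that 2b < d.\<close>
  define b where "b = 1 / (2 * \<alpha>)"
  have d: "0 < real CARD('d)" by simp
  then have \<alpha>0: "0 < \<alpha>" using \<alpha> by (meson less_trans zero_less_divide_1_iff)
  have b: "0 < b" "2 * b < real CARD('d)" "b * (2 * \<alpha>) = 1"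
    using \<alpha> \<alpha>0 d by (simp_all add: b_def field_simps)
  \<comment> \<open>From \<open>N\<close> on the radius \<rho> chosen below is at most 1/2, as the
    interval estimate demands; the \<open>+ 1\<close> keeps n positive. That radius solves C
    \<rho>^(2\<alpha>) = 1/(2n).\<close>
  define N where "N = nat \<lceil>1 / (2 * C * (1/2) powr (1 / b))\<rceil> + 1"
  let ?E = "measure lebesgue A / 2 * (1 / (2 * C)) powr b"
  have "?E * real n powr (- b) \<le> exp (- (real n * (a ^ 4 / 1728 * r\<^sup>2))) + unit_ball_vol (real CARD('d)) * r ^ CARD('d)"
    if n: "n \<ge> N" and r: "0 \<le> r" for n r
  proof -
    let ?\<rho> = "(1 / (2 * C * real n)) powr b"
    have n0: "0 < n" using n by (simp add: N_def)
    have "1 / (2 * C * (1/2) powr (1 / b)) \<le> real n" using n unfolding N_def by linarith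
    then have "1 / (2 * C * real n) \<le> (1/2) powr (1 / b)"
      using C n0 by (simp add: field_simps)
    then have "?\<rho> \<le> ((1/2) powr (1 / b)) powr b"
      using b C by (intro powr_mono2) auto
    then have \<rho>: "0 \<le> ?\<rho>" "?\<rho> \<le> 1/2" using b by (simp_all add: powr_powr)
    have "?E * real n powr (- b) = measure lebesgue A * ?\<rho> / 2"
    proof -
      have "?\<rho> = (1 / (2 * C) * (1 / real n)) powr b" by simp
      also have "\<dots> = (1 / (2 * C)) powr b * (1 / real n) powr b"
        using C by (intro powr_mult)
      also have "(1 / real n) powr b = real n powr (- b)"
        using n0 by (simp add: powr_minus_divide powr_divide)
      finally show ?thesis by simp
    qed
    also have "\<dots> \<le> (\<integral>x. \<integral>y. (1 - kernel_dist unit_interval_space U x y) ^ n \<partial>unit_interval_space \<partial>unit_interval_space)"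
    proof (rule interval_integral_dist_ge[OF U A(1,2) n0 \<rho>])
      fix x y assume xy: "x \<in> A" "y \<in> {0..1}" "\<bar>x - y\<bar> \<le> ?\<rho>"
      have "kernel_dist unit_interval_space U x y \<le> C * \<bar>x - y\<bar> powr (2 * \<alpha>)"
        using xy by (intro D)
      also have "\<dots> \<le> C * ?\<rho> powr (2 * \<alpha>)"
        using xy C \<alpha>0 by (intro mult_left_mono powr_mono2) auto
      also have "?\<rho> powr (2 * \<alpha>) = 1 / (2 * C * real n)"
        using b(3) C n0 by (simp add: powr_powr)
      also have "C * (1 / (2 * C * real n)) = 1 / (2 * real n)" using C by simp
      finally show "kernel_dist unit_interval_space U x y \<le> 1 / (2 * real n)" .
    qed
    also have "\<dots> = (\<integral>x. \<integral>y. (1 - kernel_dist unit_cube_space W x y) ^ n \<partial>unit_cube_space \<partial>unit_cube_space)"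
      using U eq graphon_scaled_inner[OF a] unfolding W[symmetric]
      by (intro equivalent_graphons_kernel_dist[symmetric]) (simp_all add: graphon_kernel_iff_graphon)
    also have "\<dots> \<le> exp (- (real n * (a ^ 4 / 1728 * r\<^sup>2))) + unit_ball_vol (real CARD('d)) * r ^ CARD('d)"
      by (rule cube_integral_dist_le[OF a W r])
    finally show ?thesis .
  qed
  then show False
    using a A(3) C b by (intro decay_comparison[of b "CARD('d)" "a ^ 4 / 1728" ?E N]) auto
qed

lemma holder_on_kernel_dist_le:
  assumes U: "graphon unit_interval_space U"
    and h: "holder_on \<alpha> ({0..1} \<times> {0..1}) (\<lambda>(s, t). U s t)"
  shows "\<exists>C>0. \<forall>x\<in>{0..1}. \<forall>y\<in>{0..1}. kernel_dist unit_interval_space U x y \<le> C * \<bar>x - y\<bar> powr (2 * \<alpha>)"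
proof -
  interpret graphon_kernel unit_interval_space U using U by (simp add: graphon_kernel_iff_graphon)
  obtain C where C: "\<And>p q. p \<in> {0..1} \<times> {0..1} \<Longrightarrow> q \<in> {0..1} \<times> {0..1} \<Longrightarrow>
      \<bar>(case p of (s, t) \<Rightarrow> U s t) - (case q of (s, t) \<Rightarrow> U s t)\<bar> \<le> C * norm (p - q) powr \<alpha>"
    using h unfolding holder_on_def by blast
  \<comment> \<open>A Hoelder constant may be zero or negative, and a positive one is wanted, hence
    \<bar>C\<bar> + 1.\<close>
  have "kernel_dist unit_interval_space U x y \<le> ((\<bar>C\<bar> + 1) * \<bar>x - y\<bar> powr \<alpha>)\<^sup>2"
    if xy: "x \<in> {0..1}" "y \<in> {0..1}" for x y
  proof (rule kernel_dist_le)
    fix z :: real assume "z \<in> space unit_interval_space"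
    then have "\<bar>U x z - U y z\<bar> \<le> C * \<bar>x - y\<bar> powr \<alpha>"
      using C[of "(x, z)" "(y, z)"] xy by (simp add: norm_Pair)
    also have "\<dots> \<le> (\<bar>C\<bar> + 1) * \<bar>x - y\<bar> powr \<alpha>"
      by (intro mult_right_mono) auto
    finally show "\<bar>U x z - U y z\<bar> \<le> (\<bar>C\<bar> + 1) * \<bar>x - y\<bar> powr \<alpha>" .
  qed (use xy in auto)
  moreover have "((\<bar>C\<bar> + 1) * \<bar>x - y\<bar> powr \<alpha>)\<^sup>2 = (\<bar>C\<bar> + 1)\<^sup>2 * \<bar>x - y\<bar> powr (2 * \<alpha>)" for x y :: real
    unfolding mult_2 powr_add by (simp add: power2_eq_square)
  ultimately show ?thesis
    by (intro exI[of _ "(\<bar>C\<bar> + 1)\<^sup>2"]) (auto simp: zero_less_power)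
qed

section \<open>Continuous graphons satisfying a polynomial relation\<close>

lemma continuous_on_slice:
  assumes "continuous_on (A \<times> B) (\<lambda>(x, y). f x y)" "x \<in> A"
  shows "continuous_on B (\<lambda>y. f x y)"
proof -
  have "continuous_on B (\<lambda>y. (\<lambda>(x, y). f x y) (x, y))"
    by (rule continuous_on_compose2[OF assms(1)]) (use assms(2) in \<open>auto intro!: continuous_intros\<close>)
  then show ?thesis by simp
qed

lemma continuous_integral_unit_interval_eq_0:
  fixes h :: "real \<Rightarrow> real"
  assumes h: "continuous_on {0..1} h" "\<And>x. x \<in> {0..1} \<Longrightarrow> 0 \<le> h x"
    and 0: "(\<integral>x. h x \<partial>unit_interval_space) = 0" and x: "x \<in> {0..1}"
  shows "h x = 0"
proof (rule has_integral_0_cbox_imp_0[of 0 1 h])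
  show "(h has_integral 0) (cbox 0 1)"
    using has_integral_integral_lebesgue_on[OF continuous_imp_integrable_real[OF h(1)]] 0
    by (simp add: cbox_interval)
qed (use assms in \<open>auto simp: cbox_interval box_real\<close>)

context
  fixes U :: "real \<Rightarrow> real \<Rightarrow> real"
  assumes U: "graphon unit_interval_space U"
    and cont: "continuous_on ({0..1} \<times> {0..1}) (\<lambda>(x, y). U x y)"
begin

interpretation graphon_kernel unit_interval_space U
  using U by (simp add: graphon_kernel_iff_graphon)

lemma continuous_iter_kernel: "continuous_on ({0..1} \<times> {0..1}) (\<lambda>(x, y). X m x y)"
proof (induction m)
  case 0
  then show ?case using cont by simp
next
  case (Suc m)
  have c: "continuous_on (({0..1} \<times> {0..1}) \<times> cbox 0 1) (\<lambda>(p, w). U (fst p) w * X m w (snd p))"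
  proof -
    have "continuous_on (({0..1} \<times> {0..1}) \<times> cbox 0 1) (\<lambda>q. (\<lambda>(x, y). U x y) (fst (fst q), snd q))"
      by (rule continuous_on_compose2[OF cont]) (auto intro!: continuous_intros)
    moreover have "continuous_on (({0..1} \<times> {0..1}) \<times> cbox 0 1) (\<lambda>q. (\<lambda>(x, y). X m x y) (snd q, snd (fst q)))"
      by (rule continuous_on_compose2[OF Suc]) (auto intro!: continuous_intros)
    ultimately show ?thesis
      by (auto simp: case_prod_beta' intro: continuous_on_mult)
  qed
  have "continuous_on ({0..1} \<times> {0..1}) (\<lambda>p. integral (cbox 0 1) (\<lambda>w. U (fst p) w * X m w (snd p)))"
    by (rule integral_continuous_on_param[OF c])
  moreover have "integral (cbox 0 1) (\<lambda>w. U x w * X m w y) = X (Suc m) x y" if "x \<in> {0..1}" "y \<in> {0..1}" for x y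
  proof -
    have [measurable]: "x \<in> space unit_interval_space" "y \<in> space unit_interval_space" using that by auto
    have "integrable unit_interval_space (\<lambda>w. U x w * X m w y)"
      using that by (intro integrable_bounded[of _ 1] abs_mult_le_1 abs_U_le_1 abs_iter_kernel_le_1) simp_all
    then show ?thesis
      by (simp add: lebesgue_integral_eq_integral cbox_interval)
  qed
  ultimately show ?case
    by (subst continuous_on_cong[OF refl, of _ _ "\<lambda>p. integral (cbox 0 1) (\<lambda>w. U (fst p) w * X m w (snd p))"]) auto
qed

text \<open>The square is continuous and nonnegative, so a zero integral forces zero values: first
  for the integral over y as a function of x, then for the integrand at that x.\<close>

lemma iter_kernel_sum_eq_0:
  assumes 0: "(\<integral>x. \<integral>y. (\<Sum>i\<in>I. c i * X (i + k) x y)\<^sup>2 \<partial>unit_interval_space \<partial>unit_interval_space) = 0"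
    and xy: "x \<in> {0..1}" "y \<in> {0..1}"
  shows "(\<Sum>i\<in>I. c i * X (i + k) x y) = 0"
proof -
  let ?f = "\<lambda>x y. \<Sum>i\<in>I. c i * X (i + k) x y"
  have c: "continuous_on ({0..1} \<times> {0..1}) (\<lambda>(x, y). X m x y)" for m by (rule continuous_iter_kernel)
  have cf: "continuous_on ({0..1} \<times> cbox 0 1) (\<lambda>(x, y). (?f x y)\<^sup>2)"
    using c unfolding case_prod_beta' cbox_interval by (intro continuous_intros)
  have cy: "continuous_on {0..1} (\<lambda>y. (?f x y)\<^sup>2)" if "x \<in> {0..1}" for x
    using continuous_on_slice[OF cf that] by (simp add: cbox_interval)
  have cint: "continuous_on {0..1} (\<lambda>x. \<integral>y. (?f x y)\<^sup>2 \<partial>unit_interval_space)"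
  proof -
    have "continuous_on {0..1} (\<lambda>x. integral (cbox 0 1) (\<lambda>y. (?f x y)\<^sup>2))"
      by (rule integral_continuous_on_param[OF cf])
    moreover have "integral (cbox 0 1) (\<lambda>y. (?f x y)\<^sup>2) = (\<integral>y. (?f x y)\<^sup>2 \<partial>unit_interval_space)" if "x \<in> {0..1}" for x
      using lebesgue_integral_eq_integral[OF continuous_imp_integrable_real[OF cy[OF that]]]
      by (simp add: cbox_interval)
    ultimately show ?thesis by (rule continuous_on_eq)
  qed
  have inner: "(\<integral>y. (?f x y)\<^sup>2 \<partial>unit_interval_space) = 0"
    by (rule continuous_integral_unit_interval_eq_0[OF cint _ 0 xy(1)]) simp
  have "(?f x y)\<^sup>2 = 0"
    by (rule continuous_integral_unit_interval_eq_0[OF cy[OF xy(1)] _ inner xy(2)]) simp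
  then show ?thesis by simp
qed

text \<open>Cancels one factor U: if P(U) U = 0, where P(U) is the sum of c i * U^(i+1), then P(U) =
  0. Multiplying by U gives P(U) U^k = 0 for all k at least 1, and since U is symmetric, the squared
  norm of a row of P(U) is a diagonal entry of P(U)^2, a combination of such products. This reaches
  U itself, which the traces alone did not.\<close>

lemma iter_kernel_relation_lower:
  assumes rel: "\<And>x y. x \<in> {0..1} \<Longrightarrow> y \<in> {0..1} \<Longrightarrow> (\<Sum>i\<in>I. c i * X (i + 1) x y) = 0"
    and xy: "x \<in> {0..1}" "y \<in> {0..1}"
  shows "(\<Sum>i\<in>I. c i * X i x y) = 0"
proof -
  have rel': "(\<Sum>i\<in>I. c i * X (i + Suc k) x y) = 0" if "x \<in> {0..1}" "y \<in> {0..1}" for k x y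
    using that
  proof (induction k arbitrary: x)
    case 0
    then show ?case using rel by simp
  next
    case (Suc k)
    have [measurable]: "x \<in> space unit_interval_space" "y \<in> space unit_interval_space" using Suc.prems by auto
    have int: "integrable unit_interval_space (\<lambda>w. U x w * X (i + Suc k) w y)" for i
      using Suc.prems by (intro integrable_bounded[of _ 1] abs_mult_le_1 abs_U_le_1 abs_iter_kernel_le_1) simp_all
    have "(\<Sum>i\<in>I. c i * X (i + Suc (Suc k)) x y) = (\<Sum>i\<in>I. c i * (\<integral>w. U x w * X (i + Suc k) w y \<partial>unit_interval_space))"
      by simp
    also have "\<dots> = (\<integral>w. (\<Sum>i\<in>I. c i * (U x w * X (i + Suc k) w y)) \<partial>unit_interval_space)"
      using int by (simp add: Bochner_Integration.integral_sum del: add_Suc_right)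
    also have "\<dots> = (\<integral>w. U x w * (\<Sum>i\<in>I. c i * X (i + Suc k) w y) \<partial>unit_interval_space)"
      by (simp add: sum_distrib_left mult.left_commute)
    also have "\<dots> = (\<integral>w. 0 \<partial>unit_interval_space)"
      using Suc.IH Suc.prems by (intro Bochner_Integration.integral_cong) (simp_all del: add_Suc_right)
    finally show ?case by simp
  qed
  have "(\<integral>y. (\<Sum>i\<in>I. c i * X (i + 0) x y)\<^sup>2 \<partial>unit_interval_space) = 0" if x: "x \<in> space unit_interval_space" for x
  proof -
    have "(\<Sum>i\<in>I. \<Sum>j\<in>I. c i * c j * X (Suc (i + j + 2 * 0)) x x)
        = (\<Sum>i\<in>I. c i * (\<Sum>j\<in>I. c j * X (j + Suc i) x x))"
      by (simp add: sum_distrib_left mult.assoc add.commute del: iter_kernel.simps)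
    also have "\<dots> = 0"
      using rel' x by (intro sum.neutral) (simp del: iter_kernel.simps add_Suc_right)
    finally show ?thesis by (subst square_iter_kernel_sum[OF x])
  qed
  then have "(\<integral>x. \<integral>y. (\<Sum>i\<in>I. c i * X (i + 0) x y)\<^sup>2 \<partial>unit_interval_space \<partial>unit_interval_space)
      = (\<integral>x. 0 \<partial>unit_interval_space)"
    by (rule Bochner_Integration.integral_cong[OF refl])
  then have "(\<integral>x. \<integral>y. (\<Sum>i\<in>I. c i * X (i + 0) x y)\<^sup>2 \<partial>unit_interval_space \<partial>unit_interval_space) = 0"
    by simp
  from iter_kernel_sum_eq_0[OF this xy] show ?thesis by simp
qed

text \<open>For a difference f of two rows, the relation writes p f as an integral of a function g
  against U, with g bounded by (s + 1) times the sup norm B of f. Uniform continuity of U then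
  bounds the oscillation of f on \<delta>-balls by B/2, whichever rows were chosen, so a finite net
  meets a point where \<bar>f\<bar> is at least B/2.\<close>

lemma finite_sampling_set:
  assumes sp: "0 \<le> s" "0 < p"
    and rel: "\<And>x y. x \<in> {0..1} \<Longrightarrow> y \<in> {0..1} \<Longrightarrow> p * U x y = s * X 1 x y - X 2 x y"
  shows "\<exists>T. finite T \<and> T \<subseteq> {0..1} \<and> (\<forall>x\<in>{0..1}. \<forall>x'\<in>{0..1}. \<exists>t\<in>T. \<forall>y\<in>{0..1}.
      \<bar>U x y - U x' y\<bar> \<le> 2 * \<bar>U x t - U x' t\<bar>)"
proof -
  let ?I = "unit_interval_space"
  \<comment> \<open>Chosen so that (s + 1) B \<eta> = p B / 2 at the end.\<close>
  define \<eta> where "\<eta> = p / (2 * (s + 1))"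
  have \<eta>: "0 < \<eta>" using sp by (simp add: \<eta>_def)
  have "uniformly_continuous_on ({0..1} \<times> {0..1}) (\<lambda>(x, y). U x y)"
    by (intro compact_uniformly_continuous cont compact_Times compact_Icc)
  then obtain \<delta> where \<delta>: "\<delta> > 0" and uc: "\<And>q q'. q \<in> {0..1} \<times> {0..1} \<Longrightarrow> q' \<in> {0..1} \<times> {0..1} \<Longrightarrow>
      dist q' q < \<delta> \<Longrightarrow> dist (case q' of (x, y) \<Rightarrow> U x y) (case q of (x, y) \<Rightarrow> U x y) < \<eta>"
    using \<eta> unfolding uniformly_continuous_on_def by meson
  have uc': "\<bar>U z y - U z y'\<bar> \<le> \<eta>" if "z \<in> {0..1}" "y \<in> {0..1}" "y' \<in> {0..1}" "dist y y' < \<delta>" for z y y'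
    using uc[of "(z, y')" "(z, y)"] that by (auto simp: dist_Pair_Pair dist_real_def)
  \<comment> \<open>The net depends on U and \<delta> only, not on the two rows compared
    below.\<close>
  obtain T where T: "T \<subseteq> {0..1}" "finite T" "{0..1::real} \<subseteq> (\<Union>t\<in>T. ball t \<delta>)"
    by (rule compactE_image[OF compact_Icc, of "{0..1::real}" "\<lambda>t. ball t \<delta>" 0 1]) (use \<delta> in auto)
  have "\<exists>t\<in>T. \<forall>y\<in>{0..1}. \<bar>U x y - U x' y\<bar> \<le> 2 * \<bar>U x t - U x' t\<bar>" if x: "x \<in> {0..1}" "x' \<in> {0..1}" for x x'
  proof -
    have xs: "x \<in> space ?I" "x' \<in> space ?I" using x by auto
    note [measurable] = xs
    define f where "f y = U x y - U x' y" for y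
    have cU: "continuous_on {0..1} (\<lambda>y. U v y)" if "v \<in> {0..1}" for v
      using continuous_on_slice[OF cont that] .
    have "continuous_on {0..1} (\<lambda>y. \<bar>f y\<bar>)"
      unfolding f_def using x by (intro continuous_intros cU)
    then obtain y0 where y0: "y0 \<in> {0..1}" "\<And>y. y \<in> {0..1} \<Longrightarrow> \<bar>f y\<bar> \<le> \<bar>f y0\<bar>"
      using continuous_attains_sup[of "{0..1::real}" "\<lambda>y. \<bar>f y\<bar>"] by auto
    define B where "B = \<bar>f y0\<bar>"
    have sB: "0 \<le> (s + 1) * B" using sp by (simp add: B_def)
    \<comment> \<open>Factoring one U out of s U^2 - U^3 leaves s U - U^2; \<open>g\<close> is the
      difference of its rows at x and x'.\<close>
    define g where "g w = s * (U x w - U x' w) - (X 1 x w - X 1 x' w)" for w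
    have g_le: "\<bar>g w\<bar> \<le> (s + 1) * B" if "w \<in> space ?I" for w
    proof -
      have "\<bar>X 1 x w - X 1 x' w\<bar> \<le> B"
        using y0 xs that by (intro iter_kernel_diff_le) (auto simp: f_def B_def)
      moreover have "\<bar>s * (U x w - U x' w)\<bar> \<le> s * B"
        using y0(2)[of w] that sp by (auto simp: abs_mult f_def B_def intro!: mult_left_mono)
      ultimately show ?thesis unfolding g_def distrib_right by linarith
    qed
    have mg [measurable]: "g \<in> borel_measurable ?I" unfolding g_def by measurable
    have gint: "integrable ?I (\<lambda>w. g w * U w y)" if y: "y \<in> {0..1}" for y
    proof (rule integrable_bounded)
      have [measurable]: "y \<in> space ?I" using y by simp
      show "(\<lambda>w. g w * U w y) \<in> borel_measurable ?I" by measurable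
      show "\<bar>g w * U w y\<bar> \<le> (s + 1) * B * 1" if "w \<in> space ?I" for w
        unfolding abs_mult using y
        by (intro mult_mono g_le[OF that] abs_U_le_1[OF that] sB abs_ge_zero) simp
    qed
    have pf: "p * f y = (\<integral>w. g w * U w y \<partial>?I)" if y: "y \<in> {0..1}" for y
    proof -
      have ys [measurable]: "y \<in> space ?I" using y by simp
      have int: "integrable ?I (\<lambda>w. X m v w * U w y)" if [measurable]: "v \<in> space ?I" for v m
        using that ys by (intro integrable_bounded[of _ 1] abs_mult_le_1 abs_U_le_1 abs_iter_kernel_le_1) simp_all
      have Xm: "X (Suc m) v y = (\<integral>w. X m v w * U w y \<partial>?I)" if "v \<in> space ?I" for v m
        using iter_kernel_add[OF that ys, of m 0] by simp
      have i0: "integrable ?I (\<lambda>w. U v w * U w y)" if "v \<in> space ?I" for v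
        using int[OF that, of 0] by simp
      have "p * f y = s * (X (Suc 0) x y - X (Suc 0) x' y) - (X (Suc 1) x y - X (Suc 1) x' y)"
        using rel[OF x(1) y] rel[OF x(2) y] by (simp add: f_def right_diff_distrib eval_nat_numeral del: iter_kernel.simps)
      also have "\<dots> = (\<integral>w. s * (U x w * U w y - U x' w * U w y) - (X 1 x w * U w y - X 1 x' w * U w y) \<partial>?I)"
        unfolding Xm[OF xs(1)] Xm[OF xs(2)] using int[OF xs(1), of 1] int[OF xs(2), of 1] i0[OF xs(1)] i0[OF xs(2)]
        by (simp del: One_nat_def iter_kernel.simps(2))
      also have "\<dots> = (\<integral>w. g w * U w y \<partial>?I)"
        by (intro Bochner_Integration.integral_cong refl) (simp add: g_def algebra_simps)
      finally show ?thesis .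
    qed
    obtain t where t: "t \<in> T" "dist y0 t < \<delta>"
      using T(3) y0(1) by (auto simp: dist_commute)
    have t01: "t \<in> {0..1}" using t T by auto
    have "p * \<bar>f y0 - f t\<bar> = \<bar>p * f y0 - p * f t\<bar>"
      using sp by (simp add: right_diff_distrib[symmetric] abs_mult)
    also have "\<dots> = \<bar>\<integral>w. g w * U w y0 - g w * U w t \<partial>?I\<bar>"
      using gint[OF y0(1)] gint[OF t01] pf[OF y0(1)] pf[OF t01] by simp
    also have "\<dots> \<le> (\<integral>w. \<bar>g w * U w y0 - g w * U w t\<bar> \<partial>?I)"
      by (rule integral_abs_bound)
    also have "\<dots> \<le> (\<integral>w. (s + 1) * B * \<eta> \<partial>?I)"
    proof (rule integral_mono)
      show "integrable ?I (\<lambda>w. \<bar>g w * U w y0 - g w * U w t\<bar>)"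
        using gint[OF y0(1)] gint[OF t01] by simp
      show "\<bar>g w * U w y0 - g w * U w t\<bar> \<le> (s + 1) * B * \<eta>" if w: "w \<in> space ?I" for w
        unfolding right_diff_distrib[symmetric] abs_mult
        using w y0(1) t01 t(2)
        by (intro mult_mono g_le[OF w] uc' sB abs_ge_zero) simp_all
    qed (rule integrable_const)
    also have "\<dots> = (s + 1) * B * \<eta>"
      by (simp only: lebesgue_integral_const prob_space scaleR_one)
    also have "\<dots> = p * (B / 2)" using sp by (simp add: \<eta>_def field_simps)
    finally have "\<bar>f y0 - f t\<bar> \<le> B / 2" using sp by simp
    then have "B \<le> 2 * \<bar>f t\<bar>" unfolding B_def by linarith
    then have "\<forall>y\<in>{0..1}. \<bar>f y\<bar> \<le> 2 * \<bar>f t\<bar>"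
      using y0(2) unfolding B_def by (meson order_trans)
    then show ?thesis using t(1) unfolding f_def by blast
  qed
  then show ?thesis using T by blast
qed

end

section \<open>Differentiable graphons\<close>

text \<open>Near x the difference quotient is within 1 of the derivative; at distance at least
  \<delta> the bound \<open>B\<close> gives slope B/\<delta>. The constant depends on x.\<close>

lemma differentiable_imp_pointwise_lipschitz:
  fixes f :: "real \<Rightarrow> real"
  assumes "f differentiable (at x within S)" and bd: "\<And>y. y \<in> S \<Longrightarrow> \<bar>f x - f y\<bar> \<le> B"
  shows "\<exists>L. \<forall>y\<in>S. \<bar>f x - f y\<bar> \<le> L * \<bar>x - y\<bar>"
proof -
  obtain D where D: "((\<lambda>y. (f y - f x) / (y - x)) \<longlongrightarrow> D) (at x within S)"
    using assms(1) by (auto simp: real_differentiable_def has_field_derivative_iff)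
  then obtain \<delta> where \<delta>: "\<delta> > 0"
    and close: "\<And>y. y \<in> S \<Longrightarrow> y \<noteq> x \<Longrightarrow> dist y x < \<delta> \<Longrightarrow> dist ((f y - f x) / (y - x)) D < 1"
    unfolding tendsto_iff eventually_at by (meson zero_less_one)
  have "\<bar>f x - f y\<bar> \<le> max (\<bar>D\<bar> + 1) (B / \<delta>) * \<bar>x - y\<bar>" if y: "y \<in> S" for y
  proof (cases "y = x \<or> \<bar>x - y\<bar> < \<delta>")
    case True
    show ?thesis
    proof (cases "y = x")
      case False
      then have "\<bar>(f y - f x) / (y - x) - D\<bar> < 1"
        using close[OF y] True by (simp add: dist_real_def abs_minus_commute)
      then have "\<bar>(f y - f x) / (y - x)\<bar> \<le> \<bar>D\<bar> + 1"
        by linarith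
      then have "\<bar>f y - f x\<bar> \<le> (\<bar>D\<bar> + 1) * \<bar>y - x\<bar>"
        using False by (simp add: abs_divide pos_divide_le_eq)
      also have "\<dots> \<le> max (\<bar>D\<bar> + 1) (B / \<delta>) * \<bar>y - x\<bar>"
        by (intro mult_right_mono) auto
      finally show ?thesis by (simp add: abs_minus_commute)
    qed simp
  next
    case False
    have "0 \<le> B" using bd[OF y] by linarith
    have "\<bar>f x - f y\<bar> \<le> B" by (rule bd[OF y])
    also have "\<dots> = B / \<delta> * \<delta>" using \<delta> by simp
    also have "\<dots> \<le> B / \<delta> * \<bar>x - y\<bar>"
      using False \<delta> \<open>0 \<le> B\<close> by (intro mult_left_mono) auto
    also have "\<dots> \<le> max (\<bar>D\<bar> + 1) (B / \<delta>) * \<bar>x - y\<bar>"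
      by (intro mult_right_mono) auto
    finally show ?thesis .
  qed
  then show ?thesis by blast
qed

lemma differentiable_on_slice:
  fixes f :: "real \<Rightarrow> real \<Rightarrow> real"
  assumes f: "(\<lambda>(s, t). f s t) differentiable_on A \<times> B" and xt: "x \<in> A" "t \<in> B"
  shows "(\<lambda>s. f s t) differentiable (at x within A)"
proof -
  have "((\<lambda>(s, t). f s t) \<circ> (\<lambda>s. (s, t))) differentiable (at x within A)"
  proof (rule differentiable_chain_within)
    show "(\<lambda>s. (s, t)) differentiable (at x within A)"
      by (auto intro!: derivative_eq_intros simp: differentiable_def)
    have "(\<lambda>(s, t). f s t) differentiable (at (x, t) within A \<times> B)"
      using f xt by (auto simp: differentiable_on_def)
    then show "(\<lambda>(s, t). f s t) differentiable (at (x, t) within (\<lambda>s. (s, t)) ` A)"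
      by (rule differentiable_within_subset) (use xt in auto)
  qed
  then show ?thesis by (simp add: o_def)
qed

text \<open>The points where a given constant works for all t in T form a closed set. Over integer
  constants these countably many sets cover [0, 1], so one of them has positive measure.\<close>

lemma pointwise_lipschitz_uniform_on_positive_measure:
  fixes g :: "'i \<Rightarrow> real \<Rightarrow> real"
  assumes T: "finite T" and g: "\<And>t. t \<in> T \<Longrightarrow> continuous_on {0..1} (g t)"
    and lip: "\<And>t x. t \<in> T \<Longrightarrow> x \<in> {0..1} \<Longrightarrow> \<exists>L. \<forall>y\<in>{0..1}. \<bar>g t x - g t y\<bar> \<le> L * \<bar>x - y\<bar>"
  shows "\<exists>A m. A \<in> sets lebesgue \<and> A \<subseteq> {0..1} \<and> 0 < measure lebesgue A \<and> (0::real) < m \<and>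
    (\<forall>x\<in>A. \<forall>y\<in>{0..1}. \<forall>t\<in>T. \<bar>g t x - g t y\<bar> \<le> m * \<bar>x - y\<bar>)"
proof -
  define A where "A m = {0..1} \<inter> (\<Inter>y\<in>{0..1}. \<Inter>t\<in>T. {x \<in> {0..1}. \<bar>g t x - g t y\<bar> \<le> real (Suc m) * \<bar>x - y\<bar>})" for m :: nat
  have "closed (A m)" for m
    unfolding A_def
    by (intro closed_Int closed_INT ballI continuous_on_closed_Collect_le continuous_intros g) auto
  then have meas: "A m \<in> sets lebesgue" for m by (simp add: borel_closed)
  have sub: "A m \<subseteq> {0..1}" for m by (auto simp: A_def)
  have cover: "{0..1} \<subseteq> (\<Union>m. A m)"
  proof
    fix x :: real assume x: "x \<in> {0..1}"
    obtain L where L: "\<And>t y. t \<in> T \<Longrightarrow> y \<in> {0..1} \<Longrightarrow> \<bar>g t x - g t y\<bar> \<le> L t * \<bar>x - y\<bar>"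
      using lip[OF _ x] by metis
    \<comment> \<open>The sum over the finite set T dominates all the constants at x
      simultaneously.\<close>
    obtain m :: nat where m: "(\<Sum>t\<in>T. \<bar>L t\<bar>) \<le> real m" using real_arch_simple by blast
    have "\<bar>g t x - g t y\<bar> \<le> real (Suc m) * \<bar>x - y\<bar>" if t: "t \<in> T" and y: "y \<in> {0..1}" for t y
    proof -
      have "L t \<le> (\<Sum>t\<in>T. \<bar>L t\<bar>)"
        using member_le_sum[of t T "\<lambda>t. \<bar>L t\<bar>"] t T by (auto intro: order_trans[OF abs_ge_self])
      then have "L t * \<bar>x - y\<bar> \<le> real (Suc m) * \<bar>x - y\<bar>"
        using m by (intro mult_right_mono) auto
      then show ?thesis using L[OF t y] by linarith
    qed
    then have "x \<in> A m" using x by (auto simp: A_def)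
    then show "x \<in> (\<Union>m. A m)" by blast
  qed
  have "\<exists>m. emeasure lebesgue (A m) \<noteq> 0"
  proof (rule ccontr)
    assume "\<not> ?thesis"
    then have "emeasure lebesgue (\<Union>m. A m) = 0"
      using meas by (intro emeasure_UN_eq_0) auto
    moreover have "emeasure lebesgue {0..1::real} \<le> emeasure lebesgue (\<Union>m. A m)"
      using meas by (intro emeasure_mono cover) auto
    ultimately show False by simp
  qed
  then obtain m where "emeasure lebesgue (A m) \<noteq> 0" by blast
  moreover have "emeasure lebesgue (A m) \<noteq> \<infinity>"
    using emeasure_mono[OF sub, of lebesgue m] by (auto simp: top_unique)
  ultimately have "0 < measure lebesgue (A m)"
    by (simp add: measure_def enn2real_positive_iff less_top zero_less_iff_neq_zero)
  moreover have "\<forall>x\<in>A m. \<forall>y\<in>{0..1}. \<forall>t\<in>T. \<bar>g t x - g t y\<bar> \<le> real (Suc m) * \<bar>x - y\<bar>"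
    by (auto simp: A_def)
  ultimately show ?thesis
    using meas[of m] sub[of m] by (intro exI[of _ "A m"] exI[of _ "real (Suc m)"]) auto
qed

text \<open>Differentiability gives Lipschitz bounds for one t at a time, with constants depending
  on the point. The sampling set reduces the sup distance of rows to finitely many t, and
  restricting x to A makes the constants uniform. The exponent 2 * 1 is the case \<alpha> =
  1.\<close>

lemma differentiable_kernel_dist_le:
  fixes a :: real and W :: "real ^ 'd \<Rightarrow> real ^ 'd \<Rightarrow> real"
  assumes a: "0 < a" "a \<le> 1 / real CARD('d)" and W: "W = (\<lambda>x y. a * (x \<bullet> y))"
    and U: "graphon unit_interval_space U" and eq: "equivalent_graphons unit_cube_space W unit_interval_space U"
    and diff: "(\<lambda>(s, t). U s t) differentiable_on ({0..1} \<times> {0..1})"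
  shows "\<exists>A C. A \<in> sets lebesgue \<and> A \<subseteq> {0..1} \<and> 0 < measure lebesgue A \<and> 0 < C \<and>
    (\<forall>x\<in>A. \<forall>y\<in>{0..1}. kernel_dist unit_interval_space U x y \<le> C * \<bar>x - y\<bar> powr (2 * 1))"
proof -
  interpret graphon_kernel unit_interval_space U using U by (simp add: graphon_kernel_iff_graphon)
  have cont: "continuous_on ({0..1} \<times> {0..1}) (\<lambda>(x, y). U x y)"
    by (rule differentiable_imp_continuous_on[OF diff])
  define d where "d = real CARD('d)"
  define s where "s = a * (1/6 + d/4)"
  define p where "p = a\<^sup>2 * (1/144 + d/48)"
  have sp: "0 \<le> s" "0 < p" using a by (simp_all add: s_def p_def d_def add_pos_nonneg)
  \<comment> \<open>The coefficients of U^2, U^3 and U^4 when the sum is shifted by 1, and of U, U^2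
    and U^3 after one factor is cancelled.\<close>
  define c where "c i = [p, - s, 1] ! i" for i :: nat
  have I: "{..<3} = {0, 1, 2::nat}" by auto
  \<comment> \<open>The relation holds pointwise on the cube; only the norm of its left-hand side
    can be moved to U, where continuity turns it back into a pointwise identity.\<close>
  have "(\<integral>x. \<integral>y. (\<Sum>i<3. c i * iter_kernel unit_cube_space W (i + 1) x y)\<^sup>2 \<partial>unit_cube_space \<partial>unit_cube_space) = 0"
  proof -
    have "(\<Sum>i<3. c i * iter_kernel unit_cube_space W (i + 1) x y) = 0" for x y
      using cube_kernel_relation[OF a W, of x y]
      by (simp add: I c_def p_def s_def d_def eval_nat_numeral del: iter_kernel.simps)
    then show ?thesis by simp
  qed
  then have "(\<integral>x. \<integral>y. (\<Sum>i<3. c i * X (i + 1) x y)\<^sup>2 \<partial>unit_interval_space \<partial>unit_interval_space) = 0"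
    using equivalent_graphons_square[of "unit_cube_space :: (real ^ 'd) measure" W unit_interval_space U 1 c "{..<3}"]
      U eq graphon_scaled_inner[OF a] unfolding W[symmetric] graphon_kernel_iff_graphon
    by simp
  note rel1 = iter_kernel_sum_eq_0[OF U cont this]
  have "(\<Sum>i<3. c i * X i x y) = 0" if "x \<in> {0..1}" "y \<in> {0..1}" for x y
    by (rule iter_kernel_relation_lower[OF U cont rel1 that])
  then have "p * U x y = s * X 1 x y - X 2 x y" if "x \<in> {0..1}" "y \<in> {0..1}" for x y
    using that by (fastforce simp: I c_def simp del: iter_kernel.simps(2))
  from finite_sampling_set[OF U cont sp this] obtain T where T: "finite T" "T \<subseteq> {0..1}"
    and samp: "\<And>x x'. x \<in> {0..1} \<Longrightarrow> x' \<in> {0..1} \<Longrightarrow> \<exists>t\<in>T. \<forall>y\<in>{0..1}. \<bar>U x y - U x' y\<bar> \<le> 2 * \<bar>U x t - U x' t\<bar>"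
    by blast
  have dU: "(\<lambda>x. U x t) differentiable (at x within {0..1})" if "x \<in> {0..1}" "t \<in> {0..1}" for x t
    by (rule differentiable_on_slice[OF diff that])
  have lipU: "\<exists>L. \<forall>y\<in>{0..1}. \<bar>U x t - U y t\<bar> \<le> L * \<bar>x - y\<bar>" if xt: "x \<in> {0..1}" "t \<in> {0..1}" for x t
  proof (rule differentiable_imp_pointwise_lipschitz[OF dU[OF xt]])
    show "\<bar>U x t - U y t\<bar> \<le> 1" if "y \<in> {0..1}" for y
      using U_nonneg[of x t] U_le_1[of x t] U_nonneg[of y t] U_le_1[of y t] xt that by auto
  qed
  have contU: "continuous_on {0..1} (\<lambda>x. U x t)" if "t \<in> {0..1}" for t
    using dU that by (intro differentiable_imp_continuous_on) (auto simp: differentiable_on_def)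
  have "\<exists>A m. A \<in> sets lebesgue \<and> A \<subseteq> {0..1} \<and> 0 < measure lebesgue A \<and> (0::real) < m \<and>
      (\<forall>x\<in>A. \<forall>y\<in>{0..1}. \<forall>t\<in>T. \<bar>U x t - U y t\<bar> \<le> m * \<bar>x - y\<bar>)"
    by (rule pointwise_lipschitz_uniform_on_positive_measure[OF T(1)])
      (rule contU lipU; use T(2) in blast)+
  then obtain A m where A: "A \<in> sets lebesgue" "A \<subseteq> {0..1}" "0 < measure lebesgue A" "0 < m"
    and Am: "\<And>x y t. x \<in> A \<Longrightarrow> y \<in> {0..1} \<Longrightarrow> t \<in> T \<Longrightarrow> \<bar>U x t - U y t\<bar> \<le> m * \<bar>x - y\<bar>"
    by blast
  have "kernel_dist unit_interval_space U x y \<le> (2 * m)\<^sup>2 * \<bar>x - y\<bar> powr (2 * 1)" if x: "x \<in> A" and y: "y \<in> {0..1}" for x y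
  proof -
    have x01: "x \<in> {0..1}" using x A by auto
    obtain t where t: "t \<in> T" "\<And>z. z \<in> {0..1} \<Longrightarrow> \<bar>U x z - U y z\<bar> \<le> 2 * \<bar>U x t - U y t\<bar>"
      using samp[OF x01 y] by blast
    have "kernel_dist unit_interval_space U x y \<le> (2 * (m * \<bar>x - y\<bar>))\<^sup>2"
    proof (rule kernel_dist_le)
      show "\<bar>U x z - U y z\<bar> \<le> 2 * (m * \<bar>x - y\<bar>)" if "z \<in> space unit_interval_space" for z
        using t(2)[of z] Am[OF x y t(1)] that by simp
    qed (use x01 y in auto)
    also have "\<dots> = (2 * m)\<^sup>2 * \<bar>x - y\<bar> powr (2 * 1)"
      by (cases "x = y") (simp_all add: power_mult_distrib)
    finally show ?thesis .
  qed
  then show ?thesis using A by (intro exI[of _ A] exI[of _ "(2 * m)\<^sup>2"]) auto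
qed

theorem mainTheorem2:
  fixes a :: real and W :: "real ^ 'd \<Rightarrow> real ^ 'd \<Rightarrow> real"
  assumes "CARD('d) \<ge> 2"
    and "0 < a" and "a \<le> 1 / real CARD('d)"
    and W: "W = (\<lambda>x y. a * (x \<bullet> y))"
  shows "(\<forall>\<alpha> U. 0 < \<alpha> \<and> \<alpha> \<le> 1 \<and> \<alpha> > 1 / real CARD('d) \<and>
            graphon unit_interval_space U \<and>
            holder_on \<alpha> ({0..1} \<times> {0..1}) (\<lambda>(s, t). U s t) \<longrightarrow>
            \<not> equivalent_graphons unit_cube_space W unit_interval_space U)
       \<and> (\<forall>U. graphon unit_interval_space U \<and>
            (\<exists>C. C-lipschitz_on ({0..1} \<times> {0..1}) (\<lambda>(s, t). U s t)) \<longrightarrow>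
            \<not> equivalent_graphons unit_cube_space W unit_interval_space U)
       \<and> (\<forall>U. graphon unit_interval_space U \<and>
            (\<lambda>(s, t). U s t) differentiable_on ({0..1} \<times> {0..1}) \<longrightarrow>
            \<not> equivalent_graphons unit_cube_space W unit_interval_space U)"
proof -
  \<comment> \<open>With d at least 2 the exponent 1 exceeds 1/d, which covers the Lipschitz and the
    differentiable case.\<close>
  have d: "1 / real CARD('d) < 1" using assms(1) by simp
  have holder: "\<not> equivalent_graphons unit_cube_space W unit_interval_space U"
    if \<alpha>: "1 / real CARD('d) < \<alpha>" and U: "graphon unit_interval_space U"
      and h: "holder_on \<alpha> ({0..1} \<times> {0..1}) (\<lambda>(s, t). U s t)" for \<alpha> U
  proof
    assume eq: "equivalent_graphons unit_cube_space W unit_interval_space U"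
    from holder_on_kernel_dist_le[OF U h] obtain C where "0 < C"
      "\<And>x y. x \<in> {0..1} \<Longrightarrow> y \<in> {0..1} \<Longrightarrow> kernel_dist unit_interval_space U x y \<le> C * \<bar>x - y\<bar> powr (2 * \<alpha>)"
      by blast
    then show False
      by (intro equivalent_cube_interval_dist_False[OF assms(2-3) W U eq \<alpha>, of "{0..1}" C]) auto
  qed
  have diff: "\<not> equivalent_graphons unit_cube_space W unit_interval_space U"
    if U: "graphon unit_interval_space U" and "(\<lambda>(s, t). U s t) differentiable_on ({0..1} \<times> {0..1})" for U
  proof
    assume eq: "equivalent_graphons unit_cube_space W unit_interval_space U"
    from differentiable_kernel_dist_le[OF assms(2-3) W U eq that(2)] obtain A C where
      "A \<in> sets lebesgue" "A \<subseteq> {0..1}" "0 < measure lebesgue A" "0 < C"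
      "\<And>x y. x \<in> A \<Longrightarrow> y \<in> {0..1} \<Longrightarrow> kernel_dist unit_interval_space U x y \<le> C * \<bar>x - y\<bar> powr (2 * 1)"
      by blast
    then show False
      by (rule equivalent_cube_interval_dist_False[OF assms(2-3) W U eq d])
  qed
  show ?thesis
    unfolding holder_on_1_iff_lipschitz[symmetric] using holder holder[OF d] diff by blast
qed

end
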